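(* For all $\beta>0$, $\lambda\in\mathbb R$, $h\in\mathbb R$ and all integers $N_1,N_2\ge1$ with $N=N_1+N_2$, $$N A_N(\beta,\lambda,h)\ \ge\ N_1A_{N_1}(\beta,\lambda,h)+N_2A_{N_2}(\beta,\lambda,h).$$
   Context: For $N\ge 1$, $\beta>0$, $\lambda\in\mathbb{R}$, $h\in\mathbb{R}$, let $J=(J_{ij})_{i,j=1}^N$ be $N^2$ i.i.d. standard Gaussian $\mathcal N(0,1)$ random variables (one for each ordered pair $(i,j)$, diagonal pairs included). $\mathbb E_z$ denotes integration with respect to the standard Gaussian measure $(2\pi)^{-N/2}e^{-\|z\|^2/2}dz$ on $\mathbb R^N$, and $\mathbb E$ denotes expectation with respect to the disorder. The partition function is $$Z_N(\beta,\lambda,h;J)=\mathbb E_z\exp\Big(\frac{\beta}{\sqrt{2N}}\sum_{i,j=1}^N J_{ij}z_iz_j+\beta h\sum_{i=1}^N z_i-\frac{\beta^2}{4N}\Big(\sum_{i=1}^N z_i^2\Big)^2+\frac{\lambda}{2}\sum_{i=1}^N z_i^2\Big),$$ and the pressure is $A_N(\beta,\lambda,h)=\frac1N\mathbb E\log Z_N(\beta,\lambda,h;J)$. *)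

theory Defs
  imports "HOL-Probability.Probability"
begin

definition gauss_vec :: "nat \<Rightarrow> (nat \<Rightarrow> real) measure" where
  "gauss_vec N = PiM {..<N} (\<lambda>_. std_normal_distribution)"

definition disorder :: "nat \<Rightarrow> (nat \<times> nat \<Rightarrow> real) measure" where
  "disorder N = PiM ({..<N} \<times> {..<N}) (\<lambda>_. std_normal_distribution)"

definition hamiltonian_exponent ::
  "nat \<Rightarrow> real \<Rightarrow> real \<Rightarrow> real \<Rightarrow> (nat \<times> nat \<Rightarrow> real) \<Rightarrow> (nat \<Rightarrow> real) \<Rightarrow> real" where
  "hamiltonian_exponent N \<beta> lam h J z =
     \<beta> / sqrt (2 * real N) * (\<Sum>i<N. \<Sum>j<N. J (i, j) * z i * z j)
     + \<beta> * h * (\<Sum>i<N. z i)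
     - \<beta>^2 / (4 * real N) * (\<Sum>i<N. (z i)^2)^2
     + lam / 2 * (\<Sum>i<N. (z i)^2)"

definition partition_fn ::
  "nat \<Rightarrow> real \<Rightarrow> real \<Rightarrow> real \<Rightarrow> (nat \<times> nat \<Rightarrow> real) \<Rightarrow> real" where
  "partition_fn N \<beta> lam h J =
     (\<integral>z. exp (hamiltonian_exponent N \<beta> lam h J z) \<partial>gauss_vec N)"

definition pressure :: "nat \<Rightarrow> real \<Rightarrow> real \<Rightarrow> real \<Rightarrow> real" where
  "pressure N \<beta> lam h = (1 / real N) * (\<integral>J. ln (partition_fn N \<beta> lam h J) \<partial>disorder N)"

end

(* Guerra-Toninelli interpolation, carried out by finite steps instead of derivatives.
   Let H_s be the Gaussian field sum_i sqrt(s_i) g_i F_i - (1/2) sum_i s_i F_i^2 with variance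
   profile s, and Z_s the integral of exp H_s against a fixed weight.  Adding a small profile t to s
   multiplies the integrand by an independent Wick exponential of mean one, so to second order
   E ln(d + Z) changes by a negative multiple of the integral of e^(cov_t(z,z')) - 1 over two
   replicas, with an error O(e^(3/2)) when t <= e.  Pointwise comparison of the covariances therefore
   compares the increments, and moving from v to u in n steps of size 1/n loses only O(n^(-1/2)).
   For the model the covariances are proportional to (a+b)^2/N (coupled) and a^2/N1 + b^2/N2
   (decoupled), a and b being the overlaps of the two blocks, and the first is at most the second by
   convexity.  Boundedness is obtained by restricting z to a cube and replacing ln by ln(d + .);
   both are removed at the end by dominated convergence, since |ln Z| <= C (1 + sum J_ij^2). *)
theory Submission
  imports Defs "HOL-Real_Asymp.Real_Asymp"
begin

section \<open>Standard Gaussian product measures\<close>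

text \<open>The quartic term of the Hamiltonian is exactly half the variance of its Gaussian part,
  so the exponent is a Wick exponent. The disorder average of the partition function is therefore
  the same for every variance profile, the first-order term of the logarithm vanishes, and no
  self-overlap term is left.

  Discrete steps need from the Gaussian only its exponential moments and the addition of variances
  of independent summands. The latter lets the part of the field already present be absorbed into
  the weight, so every step starts from profile zero with a new random weight. The price is a
  remainder that must be \<open>o(e)\<close>: the shift \<open>d\<close> bounds the third derivative
  of the logarithm by a multiple of \<open>1 / d ^ 3\<close>, and third moments of order
  \<open>e * sqrt e\<close> come from balancing second moments of order \<open>e\<close> against
  fourth moments of order \<open>e\<^sup>2\<close>. On the other hand \<open>d\<close> prevents the
  logarithm of the decoupled system from splitting into a sum, so additivity appears only after its
  removal.\<close>

lemma prob_space_std_normal: "prob_space std_normal_distribution"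
  using prob_space_normal_density[of 1 0] by simp

text \<open>Completing the square: tilting the standard density by \<open>exp (c * x)\<close> gives
  \<open>exp (c\<^sup>2 / 2)\<close> times the normal density centred at \<open>c\<close>, whose
  total mass is one.\<close>

lemma integrable_std_normal_exp: "integrable std_normal_distribution (\<lambda>x. exp (c * x))"
  and integral_std_normal_exp: "(\<integral>x. exp (c * x) \<partial>std_normal_distribution) = exp (c\<^sup>2 / 2)"
proof -
  have eq: "std_normal_density x * exp (c * x) = exp (c\<^sup>2 / 2) * normal_density c 1 x" for x
    unfolding normal_density_def
    by (simp add: exp_add[symmetric] power2_eq_square field_simps)
  have "integrable lborel (\<lambda>x. std_normal_density x * exp (c * x))"
    unfolding eq by (simp add: integrable_normal_density)
  then show "integrable std_normal_distribution (\<lambda>x. exp (c * x))"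
    by (subst integrable_density) (auto simp: normal_density_nonneg)
  have "(\<integral>x. std_normal_density x * exp (c * x) \<partial>lborel) = exp (c\<^sup>2 / 2)"
    unfolding eq by simp
  then show "(\<integral>x. exp (c * x) \<partial>std_normal_distribution) = exp (c\<^sup>2 / 2)"
    by (subst integral_density) (auto simp: normal_density_nonneg)
qed

lemma distr_std_normal_combine:
  assumes "0 \<le> s" "0 \<le> t"
  shows "distr (std_normal_distribution \<Otimes>\<^sub>M std_normal_distribution) borel
           (\<lambda>(x, y). sqrt s * x + sqrt t * y)
         = distr std_normal_distribution borel (\<lambda>x. sqrt (s + t) * x)" (is "?L = ?R")
proof -
  let ?N = std_normal_distribution
  interpret N: prob_space ?N by (rule prob_space_std_normal)
  interpret NN: pair_prob_space ?N ?N ..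
  have fst: "distr (?N \<Otimes>\<^sub>M ?N) ?N fst = ?N"
    by (rule N.distr_pair_fst)
  have snd: "distr (?N \<Otimes>\<^sub>M ?N) ?N snd = ?N"
  proof -
    have "distr (?N \<Otimes>\<^sub>M ?N) ?N snd = distr (distr (?N \<Otimes>\<^sub>M ?N) (?N \<Otimes>\<^sub>M ?N) (\<lambda>(x, y). (y, x))) ?N fst"
      by (subst distr_distr) (auto simp: o_def split_beta')
    then show ?thesis using NN.distr_pair_swap fst by simp
  qed
  have scale: "distributed (?N \<Otimes>\<^sub>M ?N) lborel (\<lambda>p. r * X p) (normal_density 0 r)"
    if "r > 0" and X[measurable]: "X \<in> (?N \<Otimes>\<^sub>M ?N) \<rightarrow>\<^sub>M ?N" and "distr (?N \<Otimes>\<^sub>M ?N) ?N X = ?N" for r X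
  proof -
    have "distr (?N \<Otimes>\<^sub>M ?N) lborel X = ?N"
      using that(3) by (metis distr_cong sets_density)
    then have "distributed (?N \<Otimes>\<^sub>M ?N) lborel X std_normal_density"
      using X unfolding distributed_def by auto
    from NN.normal_density_affine[OF this, of r 0] that show ?thesis by simp
  qed
  have scale1: "distributed ?N lborel (\<lambda>p. r * p) (normal_density 0 r)" if "r > 0" for r
  proof -
    have "distributed ?N lborel (\<lambda>x. x) std_normal_density"
      unfolding distributed_def by (auto simp: distr_id2)
    from N.normal_density_affine[OF this, of r 0] that show ?thesis by simp
  qed
  \<comment> \<open>A zero variance has no normal density, so the convolution rule for independent
    normals covers only two positive variances. The degenerate cases do occur: the decoupled profile
    puts variance zero on mixed pairs of indices.\<close>
  consider "s = 0" | "t = 0" | "s > 0" "t > 0" using assms by linarith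
  then show ?thesis
  proof cases
    case 1
    have "?L = distr (distr (?N \<Otimes>\<^sub>M ?N) ?N snd) borel (\<lambda>y. sqrt t * y)"
      by (subst distr_distr) (auto simp: 1 o_def split_beta')
    then show ?thesis by (simp add: snd 1)
  next
    case 2
    have "?L = distr (distr (?N \<Otimes>\<^sub>M ?N) ?N fst) borel (\<lambda>y. sqrt s * y)"
      by (subst distr_distr) (auto simp: 2 o_def split_beta')
    then show ?thesis by (simp add: fst 2)
  next
    case 3
    have ind0: "NN.indep_var ?N fst ?N snd"
      by (subst NN.indep_var_distribution_eq) (simp add: fst snd)
    have "NN.indep_var borel ((\<lambda>x. sqrt s * x) \<circ> fst) borel ((\<lambda>x. sqrt t * x) \<circ> snd)"
      by (rule NN.indep_var_compose[OF ind0]) auto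
    then have ind: "NN.indep_var borel (\<lambda>p. sqrt s * fst p) borel (\<lambda>p. sqrt t * snd p)"
      by (simp add: o_def)
    have "distributed (?N \<Otimes>\<^sub>M ?N) lborel (\<lambda>p. sqrt s * fst p + sqrt t * snd p)
            (normal_density (0 + 0) (sqrt ((sqrt s)\<^sup>2 + (sqrt t)\<^sup>2)))"
      by (rule NN.add_indep_normal[OF ind]) (use 3 in \<open>auto intro!: scale simp: fst snd\<close>)
    then have "distr (?N \<Otimes>\<^sub>M ?N) lborel (\<lambda>p. sqrt s * fst p + sqrt t * snd p)
                = density lborel (normal_density 0 (sqrt (s + t)))"
      using 3 by (simp add: distributed_def)
    also have "\<dots> = distr ?N lborel (\<lambda>x. sqrt (s + t) * x)"
      using scale1[of "sqrt (s + t)"] 3 by (simp add: distributed_def)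
    finally show ?thesis
      by (metis (no_types, lifting) distr_cong sets_lborel split_beta')
  qed
qed

text \<open>Common form of \<open>gauss_vec\<close>, indexed by sites, and \<open>disorder\<close>,
  indexed by pairs of sites.\<close>

definition std_gauss :: "'i set \<Rightarrow> ('i \<Rightarrow> real) measure" where
  "std_gauss I = PiM I (\<lambda>_. std_normal_distribution)"

lemma prob_space_std_gauss: "prob_space (std_gauss I)"
  unfolding std_gauss_def by (intro prob_space_PiM prob_space_std_normal)

lemma measurable_std_gauss_component [measurable (raw)]:
  "i \<in> I \<Longrightarrow> (\<lambda>x. x i) \<in> borel_measurable (std_gauss I)"
proof -
  assume "i \<in> I"
  then have "(\<lambda>x. x i) \<in> std_gauss I \<rightarrow>\<^sub>M std_normal_distribution"
    unfolding std_gauss_def by (rule measurable_component_singleton)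
  then show ?thesis by simp
qed

lemma measurable_std_gauss_component' [measurable_dest]:
  "f \<in> M \<rightarrow>\<^sub>M std_gauss I \<Longrightarrow> g \<in> L \<rightarrow>\<^sub>M M \<Longrightarrow> i \<in> I \<Longrightarrow> (\<lambda>x. f (g x) i) \<in> borel_measurable L"
  by (rule measurable_compose[OF _ measurable_compose[OF _ measurable_std_gauss_component]])

text \<open>Variances of independent Gaussian vectors add. An equality of laws is needed because the
  functional applied later, the logarithm of a partition function, depends on all coordinates at
  once.\<close>

lemma distr_std_gauss_combine:
  assumes fin: "finite I" and s: "\<And>i. i \<in> I \<Longrightarrow> 0 \<le> s i" and t: "\<And>i. i \<in> I \<Longrightarrow> 0 \<le> t i"
  shows "distr (std_gauss I \<Otimes>\<^sub>M std_gauss I) (PiM I (\<lambda>_. borel))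
           (\<lambda>(x, y). \<lambda>i\<in>I. sqrt (s i) * x i + sqrt (t i) * y i)
         = distr (std_gauss I) (PiM I (\<lambda>_. borel)) (\<lambda>x. \<lambda>i\<in>I. sqrt (s i + t i) * x i)"
    (is "?L = ?R")
proof -
  let ?N = std_normal_distribution
  let ?G = "std_gauss I"
  let ?T = "\<lambda>i. distr ?N borel (\<lambda>x. sqrt (s i + t i) * x)"
  interpret N: prob_space ?N by (rule prob_space_std_normal)
  interpret G: prob_space ?G by (rule prob_space_std_gauss)
  interpret GG: pair_prob_space ?G ?G ..
  interpret P: product_sigma_finite "\<lambda>_::'a. ?N" ..
  have T: "prob_space (?T i)" for i
    by (intro N.prob_space_distr) auto
  interpret T: product_prob_space ?T
    by (intro product_prob_spaceI T)
  have m1: "(\<lambda>(x, y). \<lambda>i\<in>I. sqrt (s i) * x i + sqrt (t i) * y i) \<in> ?G \<Otimes>\<^sub>M ?G \<rightarrow>\<^sub>M PiM I (\<lambda>_. borel)"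
    by measurable
  have m2: "(\<lambda>x. \<lambda>i\<in>I. sqrt (s i + t i) * x i) \<in> ?G \<rightarrow>\<^sub>M PiM I (\<lambda>_. borel)"
    by measurable
  \<comment> \<open>Both laws are identified with the product of the one-dimensional laws
    \<open>?T i\<close>. Boxes determine a product measure, and the indicator of a box factorises,
    which leaves the one-dimensional addition law in each coordinate.\<close>
  have "?R = PiM I ?T"
  proof (rule T.PiM_eqI[OF fin])
    show "sets ?R = sets (PiM I ?T)" by (simp cong: sets_PiM_cong)
    fix A assume "\<And>i. i \<in> I \<Longrightarrow> A i \<in> sets (?T i)"
    then have A: "\<And>i. i \<in> I \<Longrightarrow> A i \<in> sets borel" by simp
    have "emeasure ?R (Pi\<^sub>E I A) = (\<integral>\<^sup>+x. indicator (Pi\<^sub>E I A) x \<partial>?R)"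
      using A fin by (subst nn_integral_indicator) (auto intro!: sets_PiM_I_finite)
    also have "\<dots> = (\<integral>\<^sup>+x. indicator (Pi\<^sub>E I A) (\<lambda>i\<in>I. sqrt (s i + t i) * x i) \<partial>?G)"
      using A fin by (subst nn_integral_distr[OF m2]) (auto intro!: borel_measurable_indicator sets_PiM_I_finite)
    also have "\<dots> = (\<integral>\<^sup>+x. (\<Prod>i\<in>I. indicator (A i) (sqrt (s i + t i) * x i)) \<partial>?G)"
      by (intro nn_integral_cong) (auto simp: indicator_def prod.If_cases fin PiE_iff split: if_splits)
    also have "\<dots> = (\<Prod>i\<in>I. (\<integral>\<^sup>+x. indicator (A i) (sqrt (s i + t i) * x) \<partial>?N))"
      unfolding std_gauss_def
    proof (rule P.product_nn_integral_prod[OF fin, where f="\<lambda>i x. indicator (A i) (sqrt (s i + t i) * x)"])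
      fix i assume "i \<in> I"
      note [measurable] = A[OF this]
      show "(\<lambda>x. indicator (A i) (sqrt (s i + t i) * x)) \<in> borel_measurable ?N" by measurable
    qed
    also have "\<dots> = (\<Prod>i\<in>I. emeasure (?T i) (A i))"
    proof (intro prod.cong refl)
      fix i assume "i \<in> I"
      note [measurable] = A[OF this]
      have "emeasure (?T i) (A i) = (\<integral>\<^sup>+x. indicator (A i) x \<partial>?T i)" by simp
      also have "\<dots> = (\<integral>\<^sup>+x. indicator (A i) (sqrt (s i + t i) * x) \<partial>?N)"
        by (rule nn_integral_distr) auto
      finally show "(\<integral>\<^sup>+x. indicator (A i) (sqrt (s i + t i) * x) \<partial>?N) = emeasure (?T i) (A i)" ..
    qed
    finally show "emeasure ?R (Pi\<^sub>E I A) = (\<Prod>i\<in>I. emeasure (?T i) (A i))" .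
  qed
  moreover have "?L = PiM I ?T"
  proof (rule T.PiM_eqI[OF fin])
    show "sets ?L = sets (PiM I ?T)" by (simp cong: sets_PiM_cong)
    fix A assume "\<And>i. i \<in> I \<Longrightarrow> A i \<in> sets (?T i)"
    then have A: "\<And>i. i \<in> I \<Longrightarrow> A i \<in> sets borel" by simp
    have "emeasure ?L (Pi\<^sub>E I A) = (\<integral>\<^sup>+x. indicator (Pi\<^sub>E I A) x \<partial>?L)"
      using A fin by (subst nn_integral_indicator) (auto intro!: sets_PiM_I_finite)
    also have "\<dots> = (\<integral>\<^sup>+p. indicator (Pi\<^sub>E I A) (case p of (x, y) \<Rightarrow> (\<lambda>i\<in>I. sqrt (s i) * x i + sqrt (t i) * y i)) \<partial>(?G \<Otimes>\<^sub>M ?G))"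
      using A fin by (subst nn_integral_distr[OF m1]) (auto intro!: borel_measurable_indicator sets_PiM_I_finite)
    also have "\<dots> = (\<integral>\<^sup>+p. (\<Prod>i\<in>I. indicator (A i) (sqrt (s i) * fst p i + sqrt (t i) * snd p i)) \<partial>(?G \<Otimes>\<^sub>M ?G))"
      by (intro nn_integral_cong) (auto simp: indicator_def prod.If_cases fin PiE_iff split: if_splits)
    also have "\<dots> = (\<integral>\<^sup>+x. \<integral>\<^sup>+y. (\<Prod>i\<in>I. indicator (A i) (sqrt (s i) * x i + sqrt (t i) * y i)) \<partial>?G \<partial>?G)"
    proof (subst G.nn_integral_fst[symmetric])
      have "(\<lambda>p. indicator (A i) (sqrt (s i) * fst p i + sqrt (t i) * snd p i) :: ennreal)
          \<in> borel_measurable (?G \<Otimes>\<^sub>M ?G)" if i: "i \<in> I" for i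
      proof -
        note [measurable] = A[OF i]
        show ?thesis using i by measurable
      qed
      then show "(\<lambda>p. \<Prod>i\<in>I. indicator (A i) (sqrt (s i) * fst p i + sqrt (t i) * snd p i) :: ennreal)
          \<in> borel_measurable (?G \<Otimes>\<^sub>M ?G)"
        by (rule borel_measurable_prod_ennreal)
    qed simp
    also have "\<dots> = (\<integral>\<^sup>+x. (\<Prod>i\<in>I. \<integral>\<^sup>+y. indicator (A i) (sqrt (s i) * x i + sqrt (t i) * y) \<partial>?N) \<partial>?G)"
      unfolding std_gauss_def
    proof (intro nn_integral_cong P.product_nn_integral_prod[OF fin, where f="\<lambda>i y. indicator (A i) (sqrt (s i) * x i + sqrt (t i) * y)" for x])
      fix x :: "'a \<Rightarrow> real" and i assume "i \<in> I"
      note [measurable] = A[OF this]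
      show "(\<lambda>y. indicator (A i) (sqrt (s i) * x i + sqrt (t i) * y)) \<in> borel_measurable ?N" by measurable
    qed
    also have "\<dots> = (\<Prod>i\<in>I. \<integral>\<^sup>+x. \<integral>\<^sup>+y. indicator (A i) (sqrt (s i) * x + sqrt (t i) * y) \<partial>?N \<partial>?N)"
      unfolding std_gauss_def
    proof (rule P.product_nn_integral_prod[OF fin, where f="\<lambda>i x. \<integral>\<^sup>+y. indicator (A i) (sqrt (s i) * x + sqrt (t i) * y) \<partial>?N"])
      fix i assume "i \<in> I"
      note [measurable] = A[OF this]
      show "(\<lambda>x. \<integral>\<^sup>+y. indicator (A i) (sqrt (s i) * x + sqrt (t i) * y) \<partial>?N) \<in> borel_measurable ?N"
        by measurable
    qed
    also have "\<dots> = (\<Prod>i\<in>I. emeasure (?T i) (A i))"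
    proof (intro prod.cong refl)
      fix i assume i: "i \<in> I"
      note [measurable] = A[OF i]
      have "(\<integral>\<^sup>+x. \<integral>\<^sup>+y. indicator (A i) (sqrt (s i) * x + sqrt (t i) * y) \<partial>?N \<partial>?N)
            = (\<integral>\<^sup>+p. indicator (A i) (case p of (x, y) \<Rightarrow> sqrt (s i) * x + sqrt (t i) * y) \<partial>(?N \<Otimes>\<^sub>M ?N))"
      proof (subst N.nn_integral_fst[symmetric])
        show "(\<lambda>p. indicator (A i) (case p of (x, y) \<Rightarrow> sqrt (s i) * x + sqrt (t i) * y) :: ennreal)
            \<in> borel_measurable (?N \<Otimes>\<^sub>M ?N)" by measurable
      qed simp
      also have "\<dots> = (\<integral>\<^sup>+x. indicator (A i) x
          \<partial>distr (?N \<Otimes>\<^sub>M ?N) borel (\<lambda>(x, y). sqrt (s i) * x + sqrt (t i) * y))"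
        by (rule nn_integral_distr[symmetric]) auto
      also have "\<dots> = emeasure (distr (?N \<Otimes>\<^sub>M ?N) borel (\<lambda>(x, y). sqrt (s i) * x + sqrt (t i) * y)) (A i)"
        by simp
      finally show "(\<integral>\<^sup>+x. \<integral>\<^sup>+y. indicator (A i) (sqrt (s i) * x + sqrt (t i) * y) \<partial>?N \<partial>?N) = emeasure (?T i) (A i)"
        by (simp add: distr_std_normal_combine s[OF i] t[OF i])
    qed
    finally show "emeasure ?L (Pi\<^sub>E I A) = (\<Prod>i\<in>I. emeasure (?T i) (A i))" .
  qed
  ultimately show ?thesis by simp
qed

lemma integrable_std_gauss_exp:
  assumes "finite I"
  shows "integrable (std_gauss I) (\<lambda>x. exp (\<Sum>i\<in>I. c i * x i))"
proof -
  interpret N: prob_space std_normal_distribution by (rule prob_space_std_normal)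
  interpret P: product_sigma_finite "\<lambda>_::'a. std_normal_distribution" ..
  show ?thesis
    unfolding exp_sum[OF assms] std_gauss_def
    by (intro P.product_integrable_prod assms integrable_std_normal_exp)
qed

lemma integral_std_gauss_exp:
  assumes "finite I"
  shows "(\<integral>x. exp (\<Sum>i\<in>I. c i * x i) \<partial>std_gauss I) = exp (\<Sum>i\<in>I. (c i)\<^sup>2 / 2)"
proof -
  interpret N: prob_space std_normal_distribution by (rule prob_space_std_normal)
  interpret P: product_sigma_finite "\<lambda>_::'a. std_normal_distribution" ..
  show ?thesis
    unfolding exp_sum[OF assms] std_gauss_def
    by (subst P.product_integral_prod)
       (auto simp: assms integrable_std_normal_exp integral_std_normal_exp)
qed

text \<open>In each coordinate \<open>exp (c * \<bar>x\<bar>)\<close> is at most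
  \<open>exp (c * x) + exp (- c * x)\<close>. This function is the envelope for Wick exponentials of
  a bounded field, and later for squares of disorder entries.\<close>

lemma integrable_std_gauss_exp_abs:
  assumes "finite I"
  shows "integrable (std_gauss I) (\<lambda>x. exp (c * (\<Sum>i\<in>I. \<bar>x i\<bar>)))"
proof -
  interpret N: prob_space std_normal_distribution by (rule prob_space_std_normal)
  interpret P: product_sigma_finite "\<lambda>_::'a. std_normal_distribution" ..
  have "integrable std_normal_distribution (\<lambda>x. exp (c * \<bar>x\<bar>))"
  proof (rule Bochner_Integration.integrable_bound)
    show "integrable std_normal_distribution (\<lambda>x. exp (c * x) + exp (- c * x))"
      by (intro Bochner_Integration.integrable_add integrable_std_normal_exp)
    show "AE x in std_normal_distribution. norm (exp (c * \<bar>x\<bar>)) \<le> norm (exp (c * x) + exp (- c * x))"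
    proof (intro AE_I2)
      fix x :: real
      have "exp (c * \<bar>x\<bar>) \<le> exp (c * x) + exp (- c * x)" by (simp add: abs_if)
      then show "norm (exp (c * \<bar>x\<bar>)) \<le> norm (exp (c * x) + exp (- c * x))" by simp
    qed
  qed simp
  then show ?thesis
    unfolding sum_distrib_left exp_sum[OF assms] std_gauss_def
    by (intro P.product_integrable_prod assms)
qed

section \<open>Gaussian fields and Wick exponentials\<close>

text \<open>An envelope in the first variable alone suffices because \<open>M\<close> has mass one.
  The Gaussian variable takes the first place: the integrands are bounded in \<open>z\<close> but
  grow exponentially in the Gaussian.\<close>

lemma dominated_Fubini:
  fixes h :: "'a \<times> 'b \<Rightarrow> real"
  assumes "prob_space P" "prob_space M"
    and h[measurable]: "h \<in> borel_measurable (P \<Otimes>\<^sub>M M)"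
    and q: "integrable P q" "\<And>y z. y \<in> space P \<Longrightarrow> z \<in> space M \<Longrightarrow> \<bar>h (y, z)\<bar> \<le> q y"
  shows integrable_dominated_pair: "integrable (P \<Otimes>\<^sub>M M) h"
    and integrable_dominated_fst: "integrable P (\<lambda>y. \<integral>z. h (y, z) \<partial>M)"
    and integrable_dominated_snd: "integrable M (\<lambda>z. \<integral>y. h (y, z) \<partial>P)"
    and integral_dominated_pair: "(\<integral>y. \<integral>z. h (y, z) \<partial>M \<partial>P) = (\<integral>p. h p \<partial>(P \<Otimes>\<^sub>M M))"
    and integral_dominated_swap:
      "(\<integral>y. \<integral>z. h (y, z) \<partial>M \<partial>P) = (\<integral>z. \<integral>y. h (y, z) \<partial>P \<partial>M)"
proof -
  interpret P: prob_space P by fact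
  interpret M: prob_space M by fact
  interpret PM: pair_prob_space P M ..
  note [measurable] = borel_measurable_integrable[OF q(1)]
  have qh: "integrable (P \<Otimes>\<^sub>M M) (\<lambda>p. q (fst p))"
    by (subst integrable_distr_eq[symmetric, where N=P and g=fst and f=q])
       (auto simp: M.distr_pair_fst q(1))
  show int: "integrable (P \<Otimes>\<^sub>M M) h"
  proof (rule Bochner_Integration.integrable_bound[OF qh h])
    show "AE p in P \<Otimes>\<^sub>M M. norm (h p) \<le> norm (q (fst p))"
    proof (rule AE_I2)
      fix p assume "p \<in> space (P \<Otimes>\<^sub>M M)"
      then have "\<bar>h (fst p, snd p)\<bar> \<le> q (fst p)"
        by (intro q(2)) (auto simp: space_pair_measure)
      then show "norm (h p) \<le> norm (q (fst p))" by simp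
    qed
  qed
  show "integrable P (\<lambda>y. \<integral>z. h (y, z) \<partial>M)"
    by (rule PM.integrable_fst'[OF int])
  show pair: "(\<integral>y. \<integral>z. h (y, z) \<partial>M \<partial>P) = (\<integral>p. h p \<partial>(P \<Otimes>\<^sub>M M))"
    by (rule PM.integral_fst'[OF int])
  have int': "integrable (P \<Otimes>\<^sub>M M) (case_prod (\<lambda>y z. h (y, z)))"
    using int by (simp add: split_beta')
  show "integrable M (\<lambda>z. \<integral>y. h (y, z) \<partial>P)"
    by (rule PM.integrable_snd[OF int'])
  show "(\<integral>y. \<integral>z. h (y, z) \<partial>M \<partial>P) = (\<integral>z. \<integral>y. h (y, z) \<partial>P \<partial>M)"
    using PM.integral_snd[OF int'] pair by (simp add: split_beta')
qed

text \<open>Lagrange remainder of third order: the third derivative of \<open>ln (d + u)\<close> is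
  \<open>2 / (d + u) ^ 3\<close>, hence at most \<open>2 / d ^ 3\<close> for nonnegative
  \<open>u\<close>. The estimate is uniform in the expansion point and holds on either side of it;
  the factor one third from \<open>2 / fact 3\<close> is given away.\<close>

lemma ln_second_order_bound:
  fixes x y d :: real
  assumes "0 \<le> x" "0 \<le> y" "0 < d"
  shows "\<bar>ln (d + y) - (ln (d + x) + (y - x) / (d + x) - (y - x)\<^sup>2 / (2 * (d + x)\<^sup>2))\<bar>
           \<le> \<bar>y - x\<bar> ^ 3 / d ^ 3"
proof (cases "y = x")
  case True
  then show ?thesis by simp
next
  case False
  \<comment> \<open>\<open>D m\<close> is the derivative of order \<open>m\<close> of
    \<open>ln (d + u)\<close>; the last branch is meant for \<open>m = 3\<close>, the order of the
    remainder.\<close>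
  define D :: "nat \<Rightarrow> real \<Rightarrow> real" where
    "D m u = (if m = 0 then ln (d + u) else if m = 1 then 1 / (d + u)
              else if m = 2 then - 1 / (d + u)\<^sup>2 else 2 / (d + u) ^ 3)" for m u
  have "\<exists>t. (if y < x then y < t \<and> t < x else x < t \<and> t < y) \<and>
      ln (d + y) = (\<Sum>m<3. D m x / fact m * (y - x) ^ m) + D 3 t / fact 3 * (y - x) ^ 3"
  proof (rule Taylor[where a=0 and b="max x y"])
    show "\<forall>m t. m < 3 \<and> 0 \<le> t \<and> t \<le> max x y \<longrightarrow> DERIV (D m) t :> D (Suc m) t"
    proof (intro allI impI)
      fix m :: nat and t :: real
      assume mt: "m < 3 \<and> 0 \<le> t \<and> t \<le> max x y"
      then have pos: "d + t > 0" using assms by linarith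
      consider "m = 0" | "m = 1" | "m = 2" using mt by linarith
      then show "DERIV (D m) t :> D (Suc m) t"
      proof cases
        case 1
        have "((\<lambda>u. ln (d + u)) has_real_derivative 1 / (d + t)) (at t)"
          using pos by (auto intro!: derivative_eq_intros)
        then show ?thesis unfolding D_def by (simp add: 1)
      next
        case 2
        have "((\<lambda>u. 1 / (d + u)) has_real_derivative - 1 / (d + t)\<^sup>2) (at t)"
          using pos by (auto intro!: derivative_eq_intros simp: power2_eq_square minus_divide_left simp del: minus_divide_left[symmetric])
        then show ?thesis unfolding D_def by (simp add: 2)
      next
        case 3
        have eq: "2 * e / (e\<^sup>2)\<^sup>2 = 2 / e ^ 3" if "e > 0" for e :: real
          using that by (simp add: divide_simps eval_nat_numeral)
        have "((\<lambda>u. - 1 / (d + u)\<^sup>2) has_real_derivative 2 * (d + t) / ((d + t)\<^sup>2)\<^sup>2) (at t)"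
          using pos by (auto intro!: derivative_eq_intros simp: power2_eq_square minus_divide_left simp del: minus_divide_left[symmetric])
        then have "((\<lambda>u. - 1 / (d + u)\<^sup>2) has_real_derivative 2 / (d + t) ^ 3) (at t)"
          by (simp only: eq[OF pos])
        then show ?thesis unfolding D_def by (simp add: 3)
      qed
    qed
  qed (use assms False in \<open>auto simp: D_def fun_eq_iff\<close>)
  then obtain t where t: "if y < x then y < t \<and> t < x else x < t \<and> t < y"
    and eq: "ln (d + y) = (\<Sum>m<3. D m x / fact m * (y - x) ^ m) + D 3 t / fact 3 * (y - x) ^ 3"
    by blast
  have t0: "0 < t" using t assms by (auto split: if_splits)
  have "(\<Sum>m<3. D m x / fact m * (y - x) ^ m)
      = ln (d + x) + (y - x) / (d + x) - (y - x)\<^sup>2 / (2 * (d + x)\<^sup>2)"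
    by (simp add: D_def numeral_3_eq_3 power2_eq_square field_simps)
  moreover have "D 3 t / fact 3 * (y - x) ^ 3 = (y - x) ^ 3 / (3 * (d + t) ^ 3)"
    by (simp add: D_def fact_numeral)
  ultimately have "\<bar>ln (d + y) - (ln (d + x) + (y - x) / (d + x) - (y - x)\<^sup>2 / (2 * (d + x)\<^sup>2))\<bar>
      = \<bar>y - x\<bar> ^ 3 / (3 * (d + t) ^ 3)"
    using eq t0 assms by (simp add: abs_divide power_abs)
  also have "\<dots> \<le> \<bar>y - x\<bar> ^ 3 / d ^ 3"
  proof (rule divide_left_mono)
    have "d ^ 3 \<le> (d + t) ^ 3" using assms t0 by (intro power_mono) auto
    also have "\<dots> \<le> 3 * (d + t) ^ 3" using assms t0 by simp
    finally show "d ^ 3 \<le> 3 * (d + t) ^ 3" .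
  qed (use assms t0 in auto)
  finally show ?thesis .
qed

text \<open>The bound on \<open>F\<close> holds at every point rather than almost everywhere, which
  gives Wick exponentials an envelope independent of \<open>z\<close>. In the model it is secured by
  a cube indicator multiplied into \<open>F\<close>.\<close>

locale gauss_field = prob_space M for M :: "'z measure" +
  fixes I :: "'i set" and F :: "'i \<Rightarrow> 'z \<Rightarrow> real" and B :: real
  assumes fin: "finite I"
    and F_measurable [measurable]: "\<And>i. i \<in> I \<Longrightarrow> F i \<in> borel_measurable M"
    and F_bound: "\<And>i z. i \<in> I \<Longrightarrow> \<bar>F i z\<bar> \<le> B"
    and B_nonneg: "0 \<le> B"
begin

abbreviation "G \<equiv> std_gauss I"

sublocale G: prob_space "std_gauss I"
  by (rule prob_space_std_gauss)

text \<open>The normal-ordered exponential. The vector \<open>x\<close> is meant to be scaled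
  already, so that \<open>x i\<close> has variance \<open>s i\<close> and subtracting half the
  variance makes the mean one. Separate arguments \<open>s\<close> and \<open>x\<close> turn
  multiplicativity into a pointwise identity.\<close>

definition wick_exp :: "('i \<Rightarrow> real) \<Rightarrow> ('i \<Rightarrow> real) \<Rightarrow> 'z \<Rightarrow> real" where
  "wick_exp s x z = exp ((\<Sum>i\<in>I. x i * F i z) - (\<Sum>i\<in>I. s i * (F i z)\<^sup>2) / 2)"

definition scaled :: "('i \<Rightarrow> real) \<Rightarrow> ('i \<Rightarrow> real) \<Rightarrow> 'i \<Rightarrow> real" where
  "scaled s x = (\<lambda>i\<in>I. sqrt (s i) * x i)"

definition cov :: "('i \<Rightarrow> real) \<Rightarrow> 'z \<Rightarrow> 'z \<Rightarrow> real" where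
  "cov s z z' = (\<Sum>i\<in>I. s i * (F i z * F i z'))"

lemma wick_exp_pos: "0 < wick_exp s x z"
  by (simp add: wick_exp_def)

text \<open>The linear part is additive in \<open>x\<close> and the correction is additive in
  \<open>s\<close>, so no cross term arises and independence is not involved; it enters only through
  the law of \<open>x + y\<close>.\<close>

lemma wick_exp_add:
  "wick_exp s x z * wick_exp t y z = wick_exp (\<lambda>i. s i + t i) (\<lambda>i\<in>I. x i + y i) z"
  unfolding wick_exp_def
  by (simp add: exp_add[symmetric] sum.distrib distrib_right add_divide_distrib)

lemma wick_exp_measurable_borel [measurable]:
  "(\<lambda>p. wick_exp s (fst p) (snd p)) \<in> borel_measurable (PiM I (\<lambda>_. borel) \<Otimes>\<^sub>M M)"
  unfolding wick_exp_def by measurable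

lemma scaled_measurable [measurable]: "scaled s \<in> G \<rightarrow>\<^sub>M PiM I (\<lambda>_. borel)"
  unfolding scaled_def by measurable

lemma wick_exp_scaled_measurable [measurable]:
  "(\<lambda>p. wick_exp s (scaled s (fst p)) (snd p)) \<in> borel_measurable (G \<Otimes>\<^sub>M M)"
proof -
  have "(\<lambda>p. (scaled s (fst p), snd p)) \<in> G \<Otimes>\<^sub>M M \<rightarrow>\<^sub>M PiM I (\<lambda>_. borel) \<Otimes>\<^sub>M M"
    by measurable
  from measurable_compose[OF this wick_exp_measurable_borel] show ?thesis by simp
qed

lemma wick_exp_le:
  assumes "\<And>i. i \<in> I \<Longrightarrow> 0 \<le> s i"
  shows "wick_exp s x z \<le> exp (B * (\<Sum>i\<in>I. \<bar>x i\<bar>))"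
proof -
  have "(\<Sum>i\<in>I. x i * F i z) \<le> (\<Sum>i\<in>I. B * \<bar>x i\<bar>)"
  proof (rule sum_mono)
    fix i assume "i \<in> I"
    have "x i * F i z \<le> \<bar>x i\<bar> * \<bar>F i z\<bar>" by (metis abs_ge_self abs_mult)
    also have "\<dots> \<le> \<bar>x i\<bar> * B" using F_bound[OF \<open>i \<in> I\<close>] by (intro mult_left_mono) auto
    finally show "x i * F i z \<le> B * \<bar>x i\<bar>" by (simp add: mult.commute)
  qed
  moreover have "0 \<le> (\<Sum>i\<in>I. s i * (F i z)\<^sup>2)"
    using assms by (intro sum_nonneg) auto
  ultimately show ?thesis
    unfolding wick_exp_def by (simp add: sum_distrib_left)
qed

text \<open>Scaling by \<open>sqrt (s i) \<le> 1\<close> does not enlarge a coordinate, so one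
  envelope serves all profiles. This is why profiles are kept in the unit interval.\<close>

lemma wick_exp_scaled_le:
  assumes "\<And>i. i \<in> I \<Longrightarrow> 0 \<le> s i \<and> s i \<le> 1"
  shows "wick_exp s (scaled s x) z \<le> exp (B * (\<Sum>i\<in>I. \<bar>x i\<bar>))"
proof -
  have "(\<Sum>i\<in>I. \<bar>scaled s x i\<bar>) \<le> (\<Sum>i\<in>I. \<bar>x i\<bar>)"
  proof (rule sum_mono)
    fix i assume i: "i \<in> I"
    have "sqrt (s i) * \<bar>x i\<bar> \<le> 1 * \<bar>x i\<bar>"
      using assms[OF i] by (intro mult_right_mono) auto
    then show "\<bar>scaled s x i\<bar> \<le> \<bar>x i\<bar>"
      using i assms[OF i] by (simp add: scaled_def abs_mult)
  qed
  then have "B * (\<Sum>i\<in>I. \<bar>scaled s x i\<bar>) \<le> B * (\<Sum>i\<in>I. \<bar>x i\<bar>)"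
    using B_nonneg by (rule mult_left_mono)
  moreover have "wick_exp s (scaled s x) z \<le> exp (B * (\<Sum>i\<in>I. \<bar>scaled s x i\<bar>))"
    using assms by (intro wick_exp_le) auto
  ultimately show ?thesis by (meson exp_le_cancel_iff order_trans)
qed

lemma wick_exp_scaled_eq:
  "wick_exp s (scaled s x) z = exp (\<Sum>i\<in>I. (sqrt (s i) * F i z) * x i) * exp (- (\<Sum>i\<in>I. s i * (F i z)\<^sup>2) / 2)"
  unfolding wick_exp_def scaled_def exp_add[symmetric]
  by (simp add: algebra_simps cong: sum.cong)

lemma cov_bound:
  assumes "\<And>i. i \<in> I \<Longrightarrow> 0 \<le> s i \<and> s i \<le> e"
  shows "\<bar>cov s z z'\<bar> \<le> real (card I) * B\<^sup>2 * e"
proof -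
  have "\<bar>cov s z z'\<bar> \<le> (\<Sum>i\<in>I. \<bar>s i * (F i z * F i z')\<bar>)"
    unfolding cov_def by (rule sum_abs)
  also have "\<dots> \<le> (\<Sum>i\<in>I. e * B\<^sup>2)"
  proof (rule sum_mono)
    fix i assume i: "i \<in> I"
    have "\<bar>F i z * F i z'\<bar> \<le> B * B"
      unfolding abs_mult using F_bound[OF i] B_nonneg by (intro mult_mono) auto
    then have "s i * \<bar>F i z * F i z'\<bar> \<le> e * (B * B)"
      using assms[OF i] by (intro mult_mono) auto
    then show "\<bar>s i * (F i z * F i z')\<bar> \<le> e * B\<^sup>2"
      using assms[OF i] by (simp add: abs_mult power2_eq_square)
  qed
  finally show ?thesis by (simp add: mult_ac)
qed

text \<open>The variance of the sum of two field values is the sum of their variances plus twice the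
  covariance. The two Wick corrections cancel the half variances, and only the covariance survives
  in the exponent.\<close>

lemma integral_wick_exp_mult:
  assumes "\<And>i. i \<in> I \<Longrightarrow> 0 \<le> s i"
  shows "(\<integral>x. wick_exp s (scaled s x) z * wick_exp s (scaled s x) z' \<partial>G) = exp (cov s z z')"
proof -
  have "(\<integral>x. wick_exp s (scaled s x) z * wick_exp s (scaled s x) z' \<partial>G)
    = (\<integral>x. exp (\<Sum>i\<in>I. (sqrt (s i) * (F i z + F i z')) * x i)
           * exp (- (\<Sum>i\<in>I. s i * (F i z)\<^sup>2) / 2 - (\<Sum>i\<in>I. s i * (F i z')\<^sup>2) / 2) \<partial>G)"
    unfolding wick_exp_scaled_eq exp_add[symmetric]
    by (intro Bochner_Integration.integral_cong refl) (simp add: mult_exp_exp algebra_simps sum.distrib)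
  also have "\<dots> = exp (\<Sum>i\<in>I. (sqrt (s i) * (F i z + F i z'))\<^sup>2 / 2)
           * exp (- (\<Sum>i\<in>I. s i * (F i z)\<^sup>2) / 2 - (\<Sum>i\<in>I. s i * (F i z')\<^sup>2) / 2)"
    by (simp add: integral_std_gauss_exp[OF fin])
  also have "(\<Sum>i\<in>I. (sqrt (s i) * (F i z + F i z'))\<^sup>2 / 2)
      = cov s z z' + (\<Sum>i\<in>I. s i * (F i z)\<^sup>2) / 2 + (\<Sum>i\<in>I. s i * (F i z')\<^sup>2) / 2"
    unfolding cov_def sum_divide_distrib sum.distrib[symmetric]
    using assms by (intro sum.cong refl) (simp add: power_mult_distrib power2_sum algebra_simps add_divide_distrib)
  finally show ?thesis by (simp add: exp_add[symmetric])
qed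

text \<open>The Gaussian moment contributes \<open>k\<^sup>2 / 2\<close> times the variance and the
  correction removes \<open>k / 2\<close> times it. At \<open>k = 0\<close> the truncated difference
  \<open>k - 1\<close> is harmless because of the factor \<open>k\<close>.\<close>

lemma wick_exp_power:
  assumes "\<And>i. i \<in> I \<Longrightarrow> 0 \<le> s i"
  shows integrable_wick_exp_power: "integrable G (\<lambda>x. wick_exp s (scaled s x) z ^ k)"
    and integral_wick_exp_power:
      "(\<integral>x. wick_exp s (scaled s x) z ^ k \<partial>G) = exp (real (k * (k - 1)) / 2 * cov s z z)"
proof -
  have eq: "wick_exp s (scaled s x) z ^ k
      = exp (\<Sum>i\<in>I. (real k * sqrt (s i) * F i z) * x i) * exp (- real k / 2 * cov s z z)" for x
    unfolding wick_exp_scaled_eq exp_add[symmetric] exp_of_nat_mult[symmetric] cov_def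
    by (simp add: algebra_simps sum_distrib_left power2_eq_square sum_negf sum_divide_distrib)
  show "integrable G (\<lambda>x. wick_exp s (scaled s x) z ^ k)"
    unfolding eq by (intro integrable_mult_left integrable_std_gauss_exp fin)
  have "(\<integral>x. wick_exp s (scaled s x) z ^ k \<partial>G)
    = exp (\<Sum>i\<in>I. (real k * sqrt (s i) * F i z)\<^sup>2 / 2) * exp (- real k / 2 * cov s z z)"
    unfolding eq by (simp add: integral_std_gauss_exp[OF fin])
  also have "(\<Sum>i\<in>I. (real k * sqrt (s i) * F i z)\<^sup>2 / 2) = (real k)\<^sup>2 / 2 * cov s z z"
    unfolding cov_def sum_distrib_left
    using assms by (intro sum.cong refl) (simp add: power_mult_distrib power2_eq_square)
  also have "exp ((real k)\<^sup>2 / 2 * cov s z z) * exp (- real k / 2 * cov s z z)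
      = exp (real (k * (k - 1)) / 2 * cov s z z)"
    unfolding exp_add[symmetric]
    by (cases k) (simp_all add: power2_eq_square field_simps)
  finally show "(\<integral>x. wick_exp s (scaled s x) z ^ k \<partial>G) = exp (real (k * (k - 1)) / 2 * cov s z z)" .
qed

text \<open>With \<open>c\<close> the variance, the binomial expansion gives
  \<open>exp (6 * c) - 4 * exp (3 * c) + 6 * exp c - 3\<close>, whose constant and linear terms
  cancel. Bounding the positive terms by \<open>1 + u + u\<^sup>2\<close>, valid for
  \<open>u \<le> 1\<close>, and the negative one by its tangent leaves \<open>36 + 6 = 42\<close>
  times \<open>c\<^sup>2\<close>; this explains the smallness condition on
  \<open>6 * c\<close>.\<close>

lemma integral_wick_exp_minus_one_power4:
  assumes s: "\<And>i. i \<in> I \<Longrightarrow> 0 \<le> s i" and small: "6 * cov s z z \<le> 1"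
  shows "integrable G (\<lambda>x. (wick_exp s (scaled s x) z - 1) ^ 4)"
    and "(\<integral>x. (wick_exp s (scaled s x) z - 1) ^ 4 \<partial>G) \<le> 42 * (cov s z z)\<^sup>2"
proof -
  let ?Y = "\<lambda>x. wick_exp s (scaled s x) z"
  have nonneg: "0 \<le> cov s z z"
    unfolding cov_def using s by (intro sum_nonneg) simp
  have eq: "(u - 1) ^ 4 = u ^ 4 - 4 * u ^ 3 + 6 * u ^ 2 - 4 * u ^ 1 + 1" for u :: real
    by algebra
  note int = integrable_wick_exp_power[OF s]
  show "integrable G (\<lambda>x. (?Y x - 1) ^ 4)"
    unfolding eq by (intro Bochner_Integration.integrable_add Bochner_Integration.integrable_diff integrable_mult_right int) auto
  have "(\<integral>x. (?Y x - 1) ^ 4 \<partial>G)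
      = (\<integral>x. ?Y x ^ 4 \<partial>G) - 4 * (\<integral>x. ?Y x ^ 3 \<partial>G) + 6 * (\<integral>x. ?Y x ^ 2 \<partial>G) - 4 * (\<integral>x. ?Y x ^ 1 \<partial>G) + 1"
    unfolding eq using int[where z=z and k=4] int[where z=z and k=3] int[where z=z and k=2] int[where z=z and k=1]
    by (simp add: G.prob_space)
  also have "\<dots> = exp (6 * cov s z z) - 4 * exp (3 * cov s z z) + 6 * exp (cov s z z) - 3"
    using integral_wick_exp_power[OF s, where z=z and k=1] by (simp add: integral_wick_exp_power s)
  also have "\<dots> \<le> 42 * (cov s z z)\<^sup>2"
  proof -
    have "exp (6 * cov s z z) \<le> 1 + 6 * cov s z z + (6 * cov s z z)\<^sup>2"
      using nonneg small by (intro exp_bound) auto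
    moreover have "exp (cov s z z) \<le> 1 + cov s z z + (cov s z z)\<^sup>2"
      using nonneg small by (intro exp_bound) auto
    moreover have "1 + 3 * cov s z z \<le> exp (3 * cov s z z)"
      by (rule exp_ge_add_one_self)
    moreover have "(6 * cov s z z)\<^sup>2 = 36 * (cov s z z)\<^sup>2"
      by (simp add: power_mult_distrib)
    ultimately show ?thesis by linarith
  qed
  finally show "(\<integral>x. (?Y x - 1) ^ 4 \<partial>G) \<le> 42 * (cov s z z)\<^sup>2" .
qed

end

section \<open>Second-order expansion of the free energy over one small step\<close>

lemma (in prob_space) square_expectation_le:
  fixes u :: "'a \<Rightarrow> real"
  assumes "integrable M u" "integrable M (\<lambda>z. (u z)\<^sup>2)"
  shows "(expectation u)\<^sup>2 \<le> expectation (\<lambda>z. (u z)\<^sup>2)"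
  using variance_eq[OF assms] variance_positive[of u] by simp

text \<open>Rearranged from \<open>(r - \<bar>D\<bar>)\<^sup>2 * D\<^sup>2 / r \<ge> 0\<close>. It
  trades the absolute third moment, for which the Wick exponentials give no closed formula, for the
  second and fourth moments, with \<open>r\<close> free for balancing the two.\<close>

lemma abs_cube_le:
  fixes D r :: real
  assumes "0 < r"
  shows "\<bar>D\<bar> ^ 3 \<le> (r * D\<^sup>2 + D ^ 4 / r) / 2"
proof -
  have "0 \<le> (r - \<bar>D\<bar>)\<^sup>2 * D\<^sup>2 / r" using assms by simp
  also have "\<dots> = r * D\<^sup>2 + \<bar>D\<bar>\<^sup>2 * D\<^sup>2 / r - 2 * (\<bar>D\<bar> * D\<^sup>2)"
    unfolding power2_diff using assms by (simp add: field_simps power2_eq_square)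
  also have "\<bar>D\<bar>\<^sup>2 * D\<^sup>2 = D ^ 4" by (simp add: power2_eq_square power4_eq_xxxx)
  also have "\<bar>D\<bar> * D\<^sup>2 = \<bar>D\<bar> ^ 3" by (simp add: power3_eq_cube power2_eq_square)
  finally show ?thesis by simp
qed

context gauss_field
begin

definition wick_int :: "('z \<Rightarrow> real) \<Rightarrow> ('i \<Rightarrow> real) \<Rightarrow> ('i \<Rightarrow> real) \<Rightarrow> real" where
  "wick_int X s x = (\<integral>z. X z * wick_exp s x z \<partial>M)"

lemma wick_int_nonneg: "(\<And>z. 0 \<le> X z) \<Longrightarrow> 0 \<le> wick_int X s x"
  unfolding wick_int_def by (intro Bochner_Integration.integral_nonneg mult_nonneg_nonneg) (auto intro: less_imp_le wick_exp_pos)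

lemma abs_ln_wick_int_le:
  assumes "\<And>z. 0 \<le> X z" "0 < d"
  shows "\<bar>ln (d + wick_int X s x)\<bar> \<le> \<bar>ln d\<bar> + wick_int X s x / d"
proof -
  let ?Z = "wick_int X s x"
  have Z: "0 \<le> ?Z" using assms by (intro wick_int_nonneg)
  have "ln (d + ?Z) = ln (d * (1 + ?Z / d))"
    using assms by (simp add: distrib_left)
  also have "\<dots> = ln d + ln (1 + ?Z / d)"
    using Z assms by (intro ln_mult_pos) (auto intro: add_pos_nonneg)
  finally have "ln (d + ?Z) = ln d + ln (1 + ?Z / d)" .
  moreover have "0 \<le> ln (1 + ?Z / d)" "ln (1 + ?Z / d) \<le> ?Z / d"
    using Z assms by (auto intro!: ln_ge_zero ln_add_one_self_le_self)
  ultimately show ?thesis by linarith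
qed

abbreviation "growth x \<equiv> exp (B * (\<Sum>i\<in>I. \<bar>x i\<bar>))"

lemma growth_ge_1: "1 \<le> growth x"
  using B_nonneg by (auto intro!: mult_nonneg_nonneg sum_nonneg)

lemma integrable_growth_power: "integrable G (\<lambda>x. growth x ^ n)"
  using integrable_std_gauss_exp_abs[OF fin, of "real n * B"]
  by (simp add: exp_of_nat_mult[symmetric] mult.assoc)

text \<open>The expansion point is the integral of \<open>X\<close>, called \<open>x\<close> in the
  proof, which is also the mean of the perturbed integral. The fluctuation \<open>D\<close> has mean
  zero and variance \<open>Q - x\<^sup>2\<close>, where \<open>Q\<close> is the two-replica
  integral. The number \<open>k * e\<close> bounds the covariance of the increment, and
  \<open>6 * (k * e) \<le> 1\<close> is what the fourth-moment estimate asks for.\<close>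

lemma one_step_approx:
  fixes X :: "'z \<Rightarrow> real"
  defines "k \<equiv> real (card I) * B\<^sup>2"
  assumes X[measurable]: "X \<in> borel_measurable M" and X0: "\<And>z. 0 \<le> X z" and XW: "\<And>z. X z \<le> W"
    and W: "1 \<le> W" and d: "0 < d" and e: "0 < e" "e \<le> 1" "6 * (k * e) \<le> 1"
    and t: "\<And>i. i \<in> I \<Longrightarrow> 0 \<le> t i \<and> t i \<le> e"
  shows "\<bar>(\<integral>y. ln (d + wick_int X t (scaled t y)) \<partial>G)
      - (ln (d + (\<integral>z. X z \<partial>M))
         - ((\<integral>p. X (fst p) * X (snd p) * exp (cov t (fst p) (snd p)) \<partial>(M \<Otimes>\<^sub>M M)) - (\<integral>z. X z \<partial>M)\<^sup>2)
            / (2 * (d + (\<integral>z. X z \<partial>M))\<^sup>2))\<bar>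
    \<le> 22 * (k + 1)\<^sup>2 * W ^ 4 * (e * sqrt e) / d ^ 3"
proof -
  let ?Y = "\<lambda>y z. wick_exp t (scaled t y) z"
  let ?Z = "\<lambda>y. wick_int X t (scaled t y)"
  define x where "x = (\<integral>z. X z \<partial>M)"
  define Q where "Q = (\<integral>p. X (fst p) * X (snd p) * exp (cov t (fst p) (snd p)) \<partial>(M \<Otimes>\<^sub>M M))"
  have PM: "prob_space M" and PG: "prob_space G" by unfold_locales
  interpret MM: pair_prob_space M M ..
  have PMM: "prob_space (M \<Otimes>\<^sub>M M)" by unfold_locales
  have k0: "0 \<le> k" unfolding k_def by simp
  have t01: "\<And>i. i \<in> I \<Longrightarrow> 0 \<le> t i \<and> t i \<le> 1" using t e by fastforce
  have t0: "\<And>i. i \<in> I \<Longrightarrow> 0 \<le> t i" using t by auto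
  have Yle: "?Y y z \<le> growth y" for y z by (rule wick_exp_scaled_le[OF t01])
  have Y0: "0 \<le> ?Y y z" for y z by (rule less_imp_le[OF wick_exp_pos])
  have Ymeas[measurable]: "(\<lambda>z. ?Y y z) \<in> borel_measurable M" for y
    unfolding wick_exp_def by measurable
  have W0: "0 \<le> W" using W by simp
  have x0: "0 \<le> x" unfolding x_def using X0 by (intro Bochner_Integration.integral_nonneg)
  have intX: "integrable M X"
    by (rule integrable_const_bound[where B=W]) (use X0 XW in \<open>auto intro!: AE_I2\<close>)
  have XY: "\<bar>X z * ?Y y z\<bar> \<le> W * growth y" for y z
    unfolding abs_mult using X0 XW Y0 Yle W0 by (intro mult_mono) auto
  have cov_le: "\<bar>cov t z z'\<bar> \<le> k * e" for z z'
    unfolding k_def by (rule cov_bound[OF t])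

  note F1 = dominated_Fubini[OF PG PM, of "\<lambda>p. X (snd p) * ?Y (fst p) (snd p)" "\<lambda>y. W * growth y"]
  have q1: "integrable G (\<lambda>y. W * growth y)"
    using integrable_growth_power[of 1] by simp
  have m1: "(\<lambda>p. X (snd p) * ?Y (fst p) (snd p)) \<in> borel_measurable (G \<Otimes>\<^sub>M M)" by measurable
  have intZ: "integrable G ?Z"
    using F1(2)[OF m1 q1] XY unfolding wick_int_def by simp
  have EZ: "(\<integral>y. ?Z y \<partial>G) = x"
    using F1(5)[OF m1 q1] XY integral_wick_exp_power[OF t0, where k=1]
    unfolding wick_int_def x_def by simp

  have prod: "(\<integral>p. f (fst p) * g (snd p) \<partial>(M \<Otimes>\<^sub>M M)) = (\<integral>z. f z \<partial>M) * (\<integral>z. g z \<partial>M)"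
    if [measurable]: "f \<in> borel_measurable M" "g \<in> borel_measurable M"
      and fg: "\<And>z. \<bar>f z\<bar> \<le> a" "\<And>z. \<bar>g z\<bar> \<le> a" for f g :: "'z \<Rightarrow> real" and a
  proof -
    have "\<bar>f z * g z'\<bar> \<le> a * a" for z z'
      unfolding abs_mult using fg[of z] fg[of z'] by (intro mult_mono) (auto intro: order_trans[OF abs_ge_zero])
    then show ?thesis
      using integral_dominated_pair[OF PM PM, of "\<lambda>p. f (fst p) * g (snd p)" "\<lambda>_. a * a"] by simp
  qed

  note F2 = dominated_Fubini[OF PG PMM,
      of "\<lambda>q. X (fst (snd q)) * X (snd (snd q)) * (?Y (fst q) (fst (snd q)) * ?Y (fst q) (snd (snd q)))"
         "\<lambda>y. W\<^sup>2 * growth y ^ 2"]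
  have q2: "integrable G (\<lambda>y. W\<^sup>2 * growth y ^ 2)"
    using integrable_growth_power[of 2] by (rule integrable_mult_right)
  have m2: "(\<lambda>q. X (fst (snd q)) * X (snd (snd q)) * (?Y (fst q) (fst (snd q)) * ?Y (fst q) (snd (snd q))))
      \<in> borel_measurable (G \<Otimes>\<^sub>M (M \<Otimes>\<^sub>M M))"
  proof -
    have 1: "(\<lambda>q. ?Y (fst q) (fst (snd q))) \<in> borel_measurable (G \<Otimes>\<^sub>M (M \<Otimes>\<^sub>M M))"
      using measurable_compose[OF _ wick_exp_scaled_measurable,
          of "\<lambda>q. (fst q, fst (snd q))" "G \<Otimes>\<^sub>M (M \<Otimes>\<^sub>M M)" t] by simp
    have 2: "(\<lambda>q. ?Y (fst q) (snd (snd q))) \<in> borel_measurable (G \<Otimes>\<^sub>M (M \<Otimes>\<^sub>M M))"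
      using measurable_compose[OF _ wick_exp_scaled_measurable,
          of "\<lambda>q. (fst q, snd (snd q))" "G \<Otimes>\<^sub>M (M \<Otimes>\<^sub>M M)" t] by simp
    show ?thesis using 1 2 by measurable
  qed
  have b2: "\<bar>X z * X z' * (?Y y z * ?Y y z')\<bar> \<le> W\<^sup>2 * growth y ^ 2" for y z z'
  proof -
    have "\<bar>(X z * ?Y y z) * (X z' * ?Y y z')\<bar> \<le> (W * growth y) * (W * growth y)"
      unfolding abs_mult[of "X z * ?Y y z"] using XY W0 by (intro mult_mono) auto
    then show ?thesis by (simp add: power2_eq_square mult_ac)
  qed
  \<comment> \<open>The square of an integral over \<open>M\<close> is an integral over two replicas
    sharing the same Gaussian \<open>y\<close>. Fubini then averages over \<open>y\<close> first,
    where the product of two Wick exponentials becomes \<open>exp\<close> of their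
    covariance.\<close>
  have Z2: "(?Z y)\<^sup>2 = (\<integral>p. X (fst p) * X (snd p) * (?Y y (fst p) * ?Y y (snd p)) \<partial>(M \<Otimes>\<^sub>M M))" for y
    using prod[of "\<lambda>z. X z * ?Y y z" "\<lambda>z. X z * ?Y y z" "W * growth y"] XY
    unfolding wick_int_def by (simp add: power2_eq_square mult_ac)
  have intZ2: "integrable G (\<lambda>y. (?Z y)\<^sup>2)"
    unfolding Z2 using F2(2)[OF m2 q2] b2 by simp
  have EZ2: "(\<integral>y. (?Z y)\<^sup>2 \<partial>G) = Q"
    unfolding Z2 Q_def using F2(5)[OF m2 q2] b2 integral_wick_exp_mult[OF t0] by simp

  define D where "D y = ?Z y - x" for y
  have D2: "(D y)\<^sup>2 = (?Z y)\<^sup>2 - 2 * x * ?Z y + x\<^sup>2" for y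
    unfolding D_def by (simp add: power2_diff)
  have intD: "integrable G D" unfolding D_def using intZ by auto
  have ED: "(\<integral>y. D y \<partial>G) = 0" unfolding D_def using intZ EZ by (simp add: G.prob_space)
  have intD2: "integrable G (\<lambda>y. (D y)\<^sup>2)" unfolding D2 using intZ intZ2 by auto
  have ED2: "(\<integral>y. (D y)\<^sup>2 \<partial>G) = Q - x\<^sup>2"
    unfolding D2 using intZ intZ2 EZ EZ2 by (simp add: G.prob_space power2_eq_square)
  \<comment> \<open>The main term keeps \<open>Q\<close> exactly; this bound of order
    \<open>e\<close> serves only the remainder. Since \<open>k * e \<le> 1\<close>, the square in
    \<open>exp u \<le> 1 + u + u\<^sup>2\<close> is absorbed, which gives the factor two.\<close>
  have Q_le: "Q - x\<^sup>2 \<le> W\<^sup>2 * (2 * (k * e))"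
  proof -
    have int1: "integrable (M \<Otimes>\<^sub>M M) (\<lambda>p. X (fst p) * X (snd p))"
      using integrable_dominated_pair[OF PM PM, of "\<lambda>p. X (fst p) * X (snd p)" "\<lambda>_. W * W"]
        X0 XW W0 by (simp add: abs_mult mult_mono)
    have cm[measurable]: "(\<lambda>p. cov t (fst p) (snd p)) \<in> borel_measurable (M \<Otimes>\<^sub>M M)"
      unfolding cov_def by measurable
    have int2: "integrable (M \<Otimes>\<^sub>M M) (\<lambda>p. X (fst p) * X (snd p) * exp (cov t (fst p) (snd p)))"
    proof (rule integrable_dominated_pair[OF PM PM, where q="\<lambda>_. W * W * exp (k * e)"])
      fix z z'
      show "\<bar>X (fst (z, z')) * X (snd (z, z')) * exp (cov t (fst (z, z')) (snd (z, z')))\<bar> \<le> W * W * exp (k * e)"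
        unfolding abs_mult using X0 XW W0 cov_le[of z z']
        by (intro mult_mono) auto
    qed auto
    have "Q - x\<^sup>2 = (\<integral>p. X (fst p) * X (snd p) * exp (cov t (fst p) (snd p)) - X (fst p) * X (snd p) \<partial>(M \<Otimes>\<^sub>M M))"
      using int1 int2 prod[of X X W] X0 XW unfolding Q_def x_def by (simp add: power2_eq_square)
    also have "\<dots> \<le> (\<integral>p. W\<^sup>2 * (2 * (k * e)) \<partial>(M \<Otimes>\<^sub>M M))"
    proof (rule integral_mono)
      fix p
      have "exp (cov t (fst p) (snd p)) \<le> exp (k * e)"
        using cov_le[of "fst p" "snd p"] by simp
      also have "\<dots> \<le> 1 + k * e + (k * e)\<^sup>2"
        using k0 e by (intro exp_bound) auto
      also have "(k * e)\<^sup>2 \<le> k * e * 1"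
        unfolding power2_eq_square using k0 e by (intro mult_left_mono) auto
      finally have "exp (cov t (fst p) (snd p)) - 1 \<le> 2 * (k * e)" by (simp add: mult_ac)
      then have "X (fst p) * X (snd p) * (exp (cov t (fst p) (snd p)) - 1) \<le> X (fst p) * X (snd p) * (2 * (k * e))"
        using X0 by (intro mult_left_mono) auto
      also have "\<dots> \<le> W * W * (2 * (k * e))"
        using X0 XW W0 k0 e by (intro mult_right_mono mult_mono) auto
      finally show "X (fst p) * X (snd p) * exp (cov t (fst p) (snd p)) - X (fst p) * X (snd p) \<le> W\<^sup>2 * (2 * (k * e))"
        by (simp add: algebra_simps power2_eq_square)
    qed (use int1 int2 in auto)
    also have "\<dots> = W\<^sup>2 * (2 * (k * e))"
      by (simp add: MM.prob_space)
    finally show ?thesis .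
  qed

  note F4 = dominated_Fubini[OF PG PM, of "\<lambda>p. (?Y (fst p) (snd p) - 1) ^ 4" "\<lambda>y. 16 * growth y ^ 4"]
  have q4: "integrable G (\<lambda>y. 16 * growth y ^ 4)"
    using integrable_growth_power[of 4] by (rule integrable_mult_right)
  have m4: "(\<lambda>p. (?Y (fst p) (snd p) - 1) ^ 4) \<in> borel_measurable (G \<Otimes>\<^sub>M M)" by measurable
  have Y1: "\<bar>?Y y z - 1\<bar> \<le> 2 * growth y" for y z
    using Y0[of y z] Yle[of y z] growth_ge_1[of y] by linarith
  have b4: "\<bar>(?Y y z - 1) ^ 4\<bar> \<le> 16 * growth y ^ 4" for y z
  proof -
    have "\<bar>?Y y z - 1\<bar> ^ 4 \<le> (2 * growth y) ^ 4" by (intro power_mono Y1) auto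
    then show ?thesis by (simp add: power_mult_distrib power_abs)
  qed
  \<comment> \<open>\<open>D y\<close> is the mean of \<open>X z * (?Y y z - 1)\<close> over
    \<open>M\<close>, and two applications of Jensen move the fourth power under the integral. The
    fourth moment of a single Wick exponential then suffices, with no four-replica integral.\<close>
  have D4_le: "(D y) ^ 4 \<le> W ^ 4 * (\<integral>z. (?Y y z - 1) ^ 4 \<partial>M)" for y
  proof -
    let ?u = "\<lambda>z. X z * (?Y y z - 1)"
    have ub: "\<bar>?u z\<bar> \<le> W * (2 * growth y)" for z
      unfolding abs_mult using X0 XW Y1 W0 by (intro mult_mono) auto
    have iu: "integrable M (\<lambda>z. ?u z ^ n)" for n
    proof (rule integrable_const_bound[where B="(W * (2 * growth y)) ^ n"])
      show "AE z in M. norm (?u z ^ n) \<le> (W * (2 * growth y)) ^ n"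
        unfolding real_norm_def power_abs by (intro AE_I2 power_mono ub) auto
    qed measurable
    have iXY: "integrable M (\<lambda>z. X z * ?Y y z)"
      by (rule integrable_const_bound[where B="W * growth y"]) (use XY in \<open>auto intro!: AE_I2\<close>)
    have "D y = (\<integral>z. ?u z \<partial>M)"
      unfolding D_def wick_int_def x_def using iXY intX by (simp add: algebra_simps)
    then have "(D y)\<^sup>2 \<le> (\<integral>z. (?u z)\<^sup>2 \<partial>M)"
      using square_expectation_le[OF iu[of 1, simplified] iu[of 2]] by simp
    then have "((D y)\<^sup>2)\<^sup>2 \<le> (\<integral>z. (?u z)\<^sup>2 \<partial>M)\<^sup>2"
      by (intro power_mono) auto
    also have "\<dots> \<le> (\<integral>z. ((?u z)\<^sup>2)\<^sup>2 \<partial>M)"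
      using square_expectation_le[of "\<lambda>z. (?u z)\<^sup>2"] iu[of 2] iu[of 4] by simp
    finally have "(D y) ^ 4 \<le> (\<integral>z. ?u z ^ 4 \<partial>M)" by simp
    also have "\<dots> \<le> (\<integral>z. W ^ 4 * (?Y y z - 1) ^ 4 \<partial>M)"
    proof (rule integral_mono[OF iu])
      show "integrable M (\<lambda>z. W ^ 4 * (?Y y z - 1) ^ 4)"
        by (rule integrable_const_bound[where B="W ^ 4 * (16 * growth y ^ 4)"])
           (use b4 W0 in \<open>auto intro!: AE_I2 mult_left_mono simp: abs_mult\<close>)
      fix z
      show "?u z ^ 4 \<le> W ^ 4 * (?Y y z - 1) ^ 4"
        unfolding power_mult_distrib using X0 XW by (intro mult_right_mono power_mono) auto
    qed
    finally show ?thesis by simp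
  qed
  have int4: "integrable G (\<lambda>y. \<integral>z. (?Y y z - 1) ^ 4 \<partial>M)"
    using F4(2)[OF m4 q4] b4 by simp
  have E4: "(\<integral>y. \<integral>z. (?Y y z - 1) ^ 4 \<partial>M \<partial>G) \<le> 42 * (k * e)\<^sup>2"
  proof -
    have "(\<integral>y. \<integral>z. (?Y y z - 1) ^ 4 \<partial>M \<partial>G) = (\<integral>z. \<integral>y. (?Y y z - 1) ^ 4 \<partial>G \<partial>M)"
      using F4(5)[OF m4 q4] b4 by simp
    also have "\<dots> \<le> (\<integral>z. 42 * (k * e)\<^sup>2 \<partial>M)"
    proof (rule integral_mono)
      show "integrable M (\<lambda>z. \<integral>y. (?Y y z - 1) ^ 4 \<partial>G)"
        using F4(3)[OF m4 q4] b4 by simp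
      fix z
      have "(\<integral>y. (?Y y z - 1) ^ 4 \<partial>G) \<le> 42 * (cov t z z)\<^sup>2"
        using cov_le[of z z] e by (intro integral_wick_exp_minus_one_power4 t0) auto
      also have "\<dots> \<le> 42 * (k * e)\<^sup>2"
        using cov_le[of z z] by (simp add: abs_le_square_iff[symmetric])
      finally show "(\<integral>y. (?Y y z - 1) ^ 4 \<partial>G) \<le> 42 * (k * e)\<^sup>2" .
    qed simp
    finally show ?thesis by (simp add: prob_space)
  qed

  define R where "R y = ln (d + ?Z y) - (ln (d + x) + D y / (d + x) - (D y)\<^sup>2 / (2 * (d + x)\<^sup>2))" for y
  \<comment> \<open>The second moment is of order \<open>e\<close> and the fourth of order
    \<open>e\<^sup>2\<close>, so \<open>r = sqrt e\<close> makes both terms of the cubic bound of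
    order \<open>e * sqrt e\<close>.\<close>
  define r where "r = sqrt e"
  have r: "0 < r" "r * r = e" using e by (auto simp: r_def)
  define U where "U y = (r * (D y)\<^sup>2 + W ^ 4 * (\<integral>z. (?Y y z - 1) ^ 4 \<partial>M) / r) / 2 / d ^ 3" for y
  have R_le: "\<bar>R y\<bar> \<le> U y" for y
  proof -
    have "\<bar>R y\<bar> \<le> \<bar>D y\<bar> ^ 3 / d ^ 3"
      unfolding R_def D_def using d x0 X0 by (intro ln_second_order_bound wick_int_nonneg)
    also have "\<bar>D y\<bar> ^ 3 \<le> (r * (D y)\<^sup>2 + (D y) ^ 4 / r) / 2"
      by (rule abs_cube_le[OF r(1)])
    also have "\<dots> \<le> (r * (D y)\<^sup>2 + W ^ 4 * (\<integral>z. (?Y y z - 1) ^ 4 \<partial>M) / r) / 2"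
      using D4_le[of y] r by (intro divide_right_mono add_left_mono) auto
    finally show ?thesis unfolding U_def using d by (simp add: divide_right_mono)
  qed
  have intU: "integrable G U" unfolding U_def using intD2 int4 by auto
  have Zmeas[measurable]: "?Z \<in> borel_measurable G" using intZ by simp
  have intln: "integrable G (\<lambda>y. ln (d + ?Z y))"
  proof (rule Bochner_Integration.integrable_bound)
    show "integrable G (\<lambda>y. \<bar>ln d\<bar> + ?Z y / d)" using intZ by auto
    show "AE y in G. norm (ln (d + ?Z y)) \<le> norm (\<bar>ln d\<bar> + ?Z y / d)"
      using abs_ln_wick_int_le[OF X0 d] by (intro AE_I2) (simp add: abs_le_iff order_trans[OF _ abs_ge_self])
  qed measurable
  have intR: "integrable G R"
    unfolding R_def using intln intD intD2 by auto
  have ER: "(\<integral>y. R y \<partial>G) = (\<integral>y. ln (d + ?Z y) \<partial>G) - (ln (d + x) - (Q - x\<^sup>2) / (2 * (d + x)\<^sup>2))"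
    unfolding R_def using intln intD intD2 ED ED2 by (simp add: G.prob_space)
  have "\<bar>\<integral>y. R y \<partial>G\<bar> \<le> (\<integral>y. \<bar>R y\<bar> \<partial>G)" by (rule integral_abs_bound)
  also have "\<dots> \<le> (\<integral>y. U y \<partial>G)"
    using intR intU R_le by (intro integral_mono) auto
  also have "\<dots> = (r * (Q - x\<^sup>2) + W ^ 4 * (\<integral>y. \<integral>z. (?Y y z - 1) ^ 4 \<partial>M \<partial>G) / r) / 2 / d ^ 3"
    unfolding U_def using intD2 int4 ED2 by simp
  also have "\<dots> \<le> (r * (W\<^sup>2 * (2 * (k * e))) + W ^ 4 * (42 * (k * e)\<^sup>2) / r) / 2 / d ^ 3"
    using Q_le E4 r d W0 by (intro divide_right_mono add_mono mult_left_mono) auto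
  also have "(r * (W\<^sup>2 * (2 * (k * e))) + W ^ 4 * (42 * (k * e)\<^sup>2) / r) / 2 = (W\<^sup>2 * k + 21 * W ^ 4 * k\<^sup>2) * (e * r)"
  proof -
    have "(k * e)\<^sup>2 / r = k\<^sup>2 * (e * r)"
      using r by (simp add: field_simps power2_eq_square)
    then have "W ^ 4 * (42 * (k * e)\<^sup>2) / r = 42 * (W ^ 4 * (k\<^sup>2 * (e * r)))"
      by (simp only: times_divide_eq_right[symmetric] mult.left_commute[of "W ^ 4"])
    then show ?thesis by (simp only:) (simp add: algebra_simps add_divide_distrib)
  qed
  \<comment> \<open>Only here the constants are merged: \<open>W \<ge> 1\<close> raises
    \<open>W\<^sup>2\<close> to \<open>W ^ 4\<close>, and \<open>k + 21 * k\<^sup>2\<close> is at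
    most \<open>22 * (k + 1)\<^sup>2\<close>.\<close>
  also have "(W\<^sup>2 * k + 21 * W ^ 4 * k\<^sup>2) * (e * r) / d ^ 3 \<le> 22 * (k + 1)\<^sup>2 * W ^ 4 * (e * r) / d ^ 3"
  proof -
    have "W\<^sup>2 \<le> W ^ 4" using W by (intro power_increasing) auto
    then have "W\<^sup>2 * k \<le> W ^ 4 * k" using k0 by (intro mult_right_mono)
    moreover have "W ^ 4 * (k + 21 * k\<^sup>2) \<le> W ^ 4 * (22 * (k + 1)\<^sup>2)"
      using k0 W0 by (intro mult_left_mono) (auto simp: power2_eq_square algebra_simps)
    ultimately have "W\<^sup>2 * k + 21 * W ^ 4 * k\<^sup>2 \<le> 22 * (k + 1)\<^sup>2 * W ^ 4"
      by (simp add: algebra_simps)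
    then show ?thesis
      using e r d by (intro divide_right_mono mult_right_mono) auto
  qed
  finally show ?thesis unfolding ER r_def x_def Q_def .
qed

text \<open>Both increments start from the same weight, so their expansions differ only in the
  two-replica integral \<open>Q\<close>. As \<open>X\<close> is nonnegative, \<open>Q\<close> is
  monotone in the covariance, and it enters with a negative sign. The constant 44 is twice 22, one
  approximation error for each side.\<close>

lemma one_step_compare:
  fixes X :: "'z \<Rightarrow> real"
  defines "k \<equiv> real (card I) * B\<^sup>2"
  assumes X[measurable]: "X \<in> borel_measurable M" and X0: "\<And>z. 0 \<le> X z" and XW: "\<And>z. X z \<le> W"
    and W: "1 \<le> W" and d: "0 < d" and e: "0 < e" "e \<le> 1" "6 * (k * e) \<le> 1"
    and t: "\<And>i. i \<in> I \<Longrightarrow> 0 \<le> t i \<and> t i \<le> e"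
    and t': "\<And>i. i \<in> I \<Longrightarrow> 0 \<le> t' i \<and> t' i \<le> e"
    and cov: "\<And>z z'. cov t z z' \<le> cov t' z z'"
  shows "(\<integral>y. ln (d + wick_int X t' (scaled t' y)) \<partial>G) - 44 * (k + 1)\<^sup>2 * W ^ 4 * (e * sqrt e) / d ^ 3
      \<le> (\<integral>y. ln (d + wick_int X t (scaled t y)) \<partial>G)"
proof -
  define x where "x = (\<integral>z. X z \<partial>M)"
  define err where "err = 22 * (k + 1)\<^sup>2 * W ^ 4 * (e * sqrt e) / d ^ 3"
  define Q where "Q s = (\<integral>p. X (fst p) * X (snd p) * exp (cov s (fst p) (snd p)) \<partial>(M \<Otimes>\<^sub>M M))" for s
  have PM: "prob_space M" by unfold_locales
  have W0: "0 \<le> W" using W by simp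
  have int: "integrable (M \<Otimes>\<^sub>M M) (\<lambda>p. X (fst p) * X (snd p) * exp (cov s (fst p) (snd p)))"
    if s: "\<And>i. i \<in> I \<Longrightarrow> 0 \<le> s i \<and> s i \<le> e" for s
  proof (rule integrable_dominated_pair[OF PM PM, where q="\<lambda>_. W * W * exp (k * e)"])
    have "(\<lambda>p. cov s (fst p) (snd p)) \<in> borel_measurable (M \<Otimes>\<^sub>M M)"
      unfolding cov_def by measurable
    then show "(\<lambda>p. X (fst p) * X (snd p) * exp (cov s (fst p) (snd p))) \<in> borel_measurable (M \<Otimes>\<^sub>M M)"
      by measurable
    fix z z'
    have "\<bar>cov s z z'\<bar> \<le> k * e" unfolding k_def by (rule cov_bound[OF s])
    then show "\<bar>X (fst (z, z')) * X (snd (z, z')) * exp (cov s (fst (z, z')) (snd (z, z')))\<bar> \<le> W * W * exp (k * e)"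
      unfolding abs_mult using X0 XW W0 by (intro mult_mono) auto
  qed auto
  have "Q t \<le> Q t'"
    unfolding Q_def using X0 cov by (intro integral_mono int t t' mult_left_mono) auto
  then have "(Q t - x\<^sup>2) / (2 * (d + x)\<^sup>2) \<le> (Q t' - x\<^sup>2) / (2 * (d + x)\<^sup>2)"
    by (intro divide_right_mono) auto
  moreover have "\<bar>(\<integral>y. ln (d + wick_int X s (scaled s y)) \<partial>G)
      - (ln (d + x) - (Q s - x\<^sup>2) / (2 * (d + x)\<^sup>2))\<bar> \<le> err"
    if "\<forall>i\<in>I. 0 \<le> s i \<and> s i \<le> e" for s
    unfolding err_def x_def Q_def k_def
    using one_step_approx[OF X X0 XW W d e[unfolded k_def], of s] that by simp
  from this[of t] this[of t'] t t' have
    "\<bar>(\<integral>y. ln (d + wick_int X t (scaled t y)) \<partial>G)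
      - (ln (d + x) - (Q t - x\<^sup>2) / (2 * (d + x)\<^sup>2))\<bar> \<le> err"
    "\<bar>(\<integral>y. ln (d + wick_int X t' (scaled t' y)) \<partial>G)
      - (ln (d + x) - (Q t' - x\<^sup>2) / (2 * (d + x)\<^sup>2))\<bar> \<le> err"
    by blast+
  moreover have "44 * (k + 1)\<^sup>2 * W ^ 4 * (e * sqrt e) / d ^ 3 = 2 * err"
    unfolding err_def by simp
  ultimately show ?thesis unfolding abs_le_iff by linarith
qed

subsection \<open>Interpolation between variance profiles\<close>

lemma wick_int_measurable:
  assumes [measurable]: "X \<in> borel_measurable M"
  shows "wick_int X s \<in> borel_measurable (PiM I (\<lambda>_. borel))"
proof -
  have "(\<lambda>p. X (snd p) * wick_exp s (fst p) (snd p)) \<in> borel_measurable (PiM I (\<lambda>_. borel) \<Otimes>\<^sub>M M)"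
    by measurable
  then have "(\<lambda>x. \<integral>z. X z * wick_exp s x z \<partial>M) \<in> borel_measurable (PiM I (\<lambda>_. borel))"
    by (intro borel_measurable_lebesgue_integral) (simp add: split_beta')
  then show ?thesis unfolding wick_int_def[abs_def] .
qed

lemma wick_exp_section_measurable [measurable]: "wick_exp s x \<in> borel_measurable M"
  unfolding wick_exp_def[abs_def] by measurable

lemma integrable_ln_wick_int:
  assumes X[measurable]: "X \<in> borel_measurable M" and X0: "\<And>z. 0 \<le> X z" and XW: "\<And>z. X z \<le> W"
    and d: "0 < d" and s: "\<And>i. i \<in> I \<Longrightarrow> 0 \<le> s i \<and> s i \<le> 1"
  shows "integrable G (\<lambda>x. ln (d + wick_int X s (scaled s x)))"
proof (rule Bochner_Integration.integrable_bound)
  have W0: "0 \<le> W" using X0 XW order_trans by blast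
  show "integrable G (\<lambda>x. \<bar>ln d\<bar> + W * growth x / d)"
    using integrable_growth_power[of 1] by simp
  show "(\<lambda>x. ln (d + wick_int X s (scaled s x))) \<in> borel_measurable G"
    using measurable_compose[OF scaled_measurable wick_int_measurable[OF X], of s s] by measurable
  show "AE x in G. norm (ln (d + wick_int X s (scaled s x))) \<le> norm (\<bar>ln d\<bar> + W * growth x / d)"
  proof (intro AE_I2)
    fix x
    have le: "X z * wick_exp s (scaled s x) z \<le> W * growth x" for z
      using X0 XW W0 wick_exp_scaled_le[OF s] by (intro mult_mono) (auto intro: less_imp_le wick_exp_pos)
    have "wick_int X s (scaled s x) \<le> W * growth x"
      unfolding wick_int_def
    proof (rule integral_le_const)
      show "integrable M (\<lambda>z. X z * wick_exp s (scaled s x) z)"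
        by (rule integrable_const_bound[where B="W * growth x"])
           (use le X0 in \<open>auto intro!: AE_I2 simp: abs_mult less_imp_le[OF wick_exp_pos]\<close>)
    qed (use le in auto)
    then have "wick_int X s (scaled s x) / d \<le> W * growth x / d"
      using d by (intro divide_right_mono) auto
    then have "\<bar>ln (d + wick_int X s (scaled s x))\<bar> \<le> \<bar>ln d\<bar> + W * growth x / d"
      using abs_ln_wick_int_le[where X=X and s=s and x="scaled s x", OF X0 d] by linarith
    then show "norm (ln (d + wick_int X s (scaled s x))) \<le> norm (\<bar>ln d\<bar> + W * growth x / d)"
      by simp
  qed
qed

definition free_energy :: "real \<Rightarrow> ('z \<Rightarrow> real) \<Rightarrow> ('i \<Rightarrow> real) \<Rightarrow> real" where
  "free_energy d X s = (\<integral>x. ln (d + wick_int X s (scaled s x)) \<partial>G)"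

lemma wick_int_add:
  "wick_int (\<lambda>z. X z * wick_exp s x z) t y = wick_int X (\<lambda>i. s i + t i) (\<lambda>i\<in>I. x i + y i)"
  unfolding wick_int_def by (simp add: mult.assoc wick_exp_add)

text \<open>A Gaussian vector with variances \<open>s + t\<close> is replaced in law by the sum of
  two independent ones. Freezing the first turns its Wick exponential into part of the weight, and
  what is averaged over the second is a step from profile zero, the situation of the one-step
  estimates.\<close>

lemma free_energy_add:
  assumes X: "X \<in> borel_measurable M" and X0: "\<And>z. 0 \<le> X z" and XW: "\<And>z. X z \<le> W"
    and d: "0 < d" and s: "\<And>i. i \<in> I \<Longrightarrow> 0 \<le> s i" and t: "\<And>i. i \<in> I \<Longrightarrow> 0 \<le> t i"
    and st: "\<And>i. i \<in> I \<Longrightarrow> s i + t i \<le> 1"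
  defines "f \<equiv> \<lambda>x y. ln (d + wick_int (\<lambda>z. X z * wick_exp s (scaled s x) z) t (scaled t y))"
  shows "free_energy d X (\<lambda>i. s i + t i) = (\<integral>x. \<integral>y. f x y \<partial>G \<partial>G)"
    and "integrable G (\<lambda>x. \<integral>y. f x y \<partial>G)"
proof -
  interpret GG: pair_prob_space G G ..
  let ?st = "\<lambda>i. s i + t i"
  let ?c = "\<lambda>(x, y). \<lambda>i\<in>I. sqrt (s i) * x i + sqrt (t i) * y i"
  let ?P = "PiM I (\<lambda>_. borel :: real measure)"
  let ?L = "\<lambda>x. ln (d + wick_int X ?st x)"
  have f: "f x y = ?L (?c (x, y))" for x y
    unfolding f_def wick_int_add by (auto simp: scaled_def intro!: arg_cong[where f="\<lambda>x. ln (d + wick_int X ?st x)"])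
  have mL: "?L \<in> borel_measurable ?P"
    using wick_int_measurable[OF X] by measurable
  have mc: "?c \<in> G \<Otimes>\<^sub>M G \<rightarrow>\<^sub>M ?P" by measurable
  have eq: "distr (G \<Otimes>\<^sub>M G) ?P ?c = distr G ?P (scaled ?st)"
    unfolding scaled_def by (rule distr_std_gauss_combine[OF fin s t])
  have "integrable G (\<lambda>x. ?L (scaled ?st x))"
    using s t st by (intro integrable_ln_wick_int[OF X X0 XW d]) (auto intro: add_nonneg_nonneg)
  then have "integrable (distr G ?P (scaled ?st)) ?L"
    by (subst integrable_distr_eq[OF scaled_measurable mL])
  then have int: "integrable (G \<Otimes>\<^sub>M G) (\<lambda>p. ?L (?c p))"
    unfolding eq[symmetric] by (subst (asm) integrable_distr_eq[OF mc mL])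
  have "free_energy d X ?st = (\<integral>x. ?L x \<partial>distr G ?P (scaled ?st))"
    unfolding free_energy_def by (rule integral_distr[OF scaled_measurable mL, symmetric])
  also have "\<dots> = (\<integral>p. ?L (?c p) \<partial>(G \<Otimes>\<^sub>M G))"
    unfolding eq[symmetric] by (rule integral_distr[OF mc mL])
  also have "\<dots> = (\<integral>x. \<integral>y. ?L (?c (x, y)) \<partial>G \<partial>G)"
    by (rule GG.integral_fst'[OF int, symmetric])
  finally show "free_energy d X ?st = (\<integral>x. \<integral>y. f x y \<partial>G \<partial>G)" unfolding f .
  show "integrable G (\<lambda>x. \<integral>y. f x y \<partial>G)"
    unfolding f by (rule GG.integrable_fst'[OF int])
qed

text \<open>With \<open>x\<close> frozen the weight \<open>X * wick_exp s\<close> is bounded by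
  \<open>W * growth x\<close> instead of \<open>W\<close>. The one-step error involves the fourth
  power of this bound, so averaging over \<open>x\<close> costs the fourth moment of
  \<open>growth\<close>, a finite constant independent of \<open>e\<close> and of the position on
  the path.\<close>

lemma free_energy_step:
  fixes X :: "'z \<Rightarrow> real"
  defines "k \<equiv> real (card I) * B\<^sup>2"
  assumes X: "X \<in> borel_measurable M" and X0: "\<And>z. 0 \<le> X z" and XW: "\<And>z. X z \<le> W"
    and W: "1 \<le> W" and d: "0 < d" and e: "0 < e" "e \<le> 1" "6 * (k * e) \<le> 1"
    and s: "\<And>i. i \<in> I \<Longrightarrow> 0 \<le> s i"
    and t: "\<And>i. i \<in> I \<Longrightarrow> 0 \<le> t i \<and> t i \<le> e \<and> s i + t i \<le> 1"
    and t': "\<And>i. i \<in> I \<Longrightarrow> 0 \<le> t' i \<and> t' i \<le> e \<and> s i + t' i \<le> 1"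
    and cov: "\<And>z z'. cov t z z' \<le> cov t' z z'"
  shows "free_energy d X (\<lambda>i. s i + t' i)
           - 44 * (k + 1)\<^sup>2 * W ^ 4 * (\<integral>x. growth x ^ 4 \<partial>G) / d ^ 3 * (e * sqrt e)
         \<le> free_energy d X (\<lambda>i. s i + t i)"
proof -
  define c where "c = 44 * (k + 1)\<^sup>2 * W ^ 4 * (e * sqrt e) / d ^ 3"
  define f where "f t x = (\<integral>y. ln (d + wick_int (\<lambda>z. X z * wick_exp s (scaled s x) z) t (scaled t y)) \<partial>G)" for t x
  have st: "\<And>i. i \<in> I \<Longrightarrow> 0 \<le> t i" "\<And>i. i \<in> I \<Longrightarrow> s i + t i \<le> 1"
     "\<And>i. i \<in> I \<Longrightarrow> 0 \<le> t' i" "\<And>i. i \<in> I \<Longrightarrow> s i + t' i \<le> 1"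
     and s1: "\<And>i. i \<in> I \<Longrightarrow> 0 \<le> s i \<and> s i \<le> 1"
     and te: "\<And>i. i \<in> I \<Longrightarrow> 0 \<le> t i \<and> t i \<le> e" "\<And>i. i \<in> I \<Longrightarrow> 0 \<le> t' i \<and> t' i \<le> e"
    using s t t' by fastforce+
  have A: "free_energy d X (\<lambda>i. s i + t i) = (\<integral>x. f t x \<partial>G)" "integrable G (f t)"
    unfolding f_def by (rule free_energy_add[OF X X0 XW d s st(1,2)]; assumption)+
  have A': "free_energy d X (\<lambda>i. s i + t' i) = (\<integral>x. f t' x \<partial>G)" "integrable G (f t')"
    unfolding f_def by (rule free_energy_add[OF X X0 XW d s st(3,4)]; assumption)+
  have W0: "0 \<le> W" using W by simp
  have pw: "f t' x - c * growth x ^ 4 \<le> f t x" for x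
  proof -
    have "f t' x - 44 * (k + 1)\<^sup>2 * (W * growth x) ^ 4 * (e * sqrt e) / d ^ 3 \<le> f t x"
      unfolding f_def k_def
    proof (rule one_step_compare[OF _ _ _ _ d e[unfolded k_def] te cov])
      show "(\<lambda>z. X z * wick_exp s (scaled s x) z) \<in> borel_measurable M"
        using X by measurable
      show "0 \<le> X z * wick_exp s (scaled s x) z" for z
        using X0 by (intro mult_nonneg_nonneg) (auto intro: less_imp_le wick_exp_pos)
      show "X z * wick_exp s (scaled s x) z \<le> W * growth x" for z
        using X0 XW W0 wick_exp_scaled_le[OF s1]
        by (intro mult_mono) (auto intro: less_imp_le wick_exp_pos)
      show "1 \<le> W * growth x"
        using mult_mono[OF W growth_ge_1[of x]] W0 by simp
    qed
    then show ?thesis unfolding c_def by (simp add: power_mult_distrib mult_ac)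
  qed
  have "free_energy d X (\<lambda>i. s i + t' i) - c * (\<integral>x. growth x ^ 4 \<partial>G)
      = (\<integral>x. f t' x - c * growth x ^ 4 \<partial>G)"
    using A'(2) integrable_growth_power[of 4] unfolding A'(1) by simp
  also have "\<dots> \<le> (\<integral>x. f t x \<partial>G)"
    using A(2) A'(2) integrable_growth_power[of 4] by (intro integral_mono pw) auto
  also have "\<dots> = free_energy d X (\<lambda>i. s i + t i)" using A(1) by simp
  finally show ?thesis unfolding c_def by (simp add: mult_ac)
qed

text \<open>The path is the segment from \<open>v\<close> to \<open>u\<close>: its points stay in
  the unit interval by convexity, and since \<open>cov\<close> is linear in the profile the assumed
  comparison passes to every small increment.\<close>

theorem free_energy_antimono:
  fixes X :: "'z \<Rightarrow> real"
  assumes X: "X \<in> borel_measurable M" and X0: "\<And>z. 0 \<le> X z" and XW: "\<And>z. X z \<le> W" and d: "0 < d"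
    and u: "\<And>i. i \<in> I \<Longrightarrow> 0 \<le> u i \<and> u i \<le> 1"
    and v: "\<And>i. i \<in> I \<Longrightarrow> 0 \<le> v i \<and> v i \<le> 1"
    and cov: "\<And>z z'. cov u z z' \<le> cov v z z'"
  shows "free_energy d X v \<le> free_energy d X u"
proof -
  \<comment> \<open>The one-step estimates merge powers of the weight bound and therefore ask for a
    bound that is at least one.\<close>
  define W' where "W' = max 1 W"
  define k where "k = real (card I) * B\<^sup>2"
  define K where "K = 44 * (k + 1)\<^sup>2 * W' ^ 4 * (\<integral>x. growth x ^ 4 \<partial>G) / d ^ 3"
  have XW': "X z \<le> W'" for z using XW[of z] by (simp add: W'_def)
  have approx: "free_energy d X v - K / sqrt (real n) \<le> free_energy d X u"
    if n: "1 \<le> n" "6 * k \<le> real n" for n :: nat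
  proof -
    \<comment> \<open>The condition \<open>6 * k \<le> real n\<close> is exactly the smallness
      condition \<open>6 * (k * e) \<le> 1\<close> of a single step.\<close>
    define e where "e = 1 / real n"
    have e: "0 < e" "e \<le> 1" "6 * (k * e) \<le> 1"
      using n by (auto simp: e_def field_simps)
    define path where "path j i = (real j * e) * u i + (1 - real j * e) * v i" for j :: nat and i
    have step: "free_energy d X (path j) - K * (e * sqrt e) \<le> free_energy d X (path (Suc j))"
      if j: "j < n" for j
    proof -
      \<comment> \<open>The common part of two neighbouring points: adding \<open>e * v\<close>
        gives \<open>path j\<close> and adding \<open>e * u\<close> gives
        \<open>path (Suc j)\<close>. One step thus compares two increments of size at most
        \<open>e\<close> over the same base profile.\<close>
      define s where "s i = (real j * e) * u i + (1 - real j * e - e) * v i" for i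
      have je: "0 \<le> real j * e" "0 \<le> 1 - real j * e - e"
      proof -
        have "real j + 1 \<le> real n" using j by linarith
        then have "(real j + 1) * e \<le> real n * e" using e by (intro mult_right_mono) auto
        moreover have "real n * e = 1" using n by (simp add: e_def)
        ultimately show "0 \<le> 1 - real j * e - e" by (simp add: algebra_simps)
      qed (use e in auto)
      have s0: "0 \<le> s i" if "i \<in> I" for i
        unfolding s_def using je e u[OF that] v[OF that] by (intro add_nonneg_nonneg mult_nonneg_nonneg) auto
      have bounds: "0 \<le> e * w i \<and> e * w i \<le> e \<and> s i + e * w i \<le> 1"
        if i: "i \<in> I" and w: "0 \<le> w i \<and> w i \<le> 1" for i and w :: "'i \<Rightarrow> real"
      proof -
        have "s i \<le> (real j * e) * 1 + (1 - real j * e - e) * 1"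
          unfolding s_def using je u[OF i] v[OF i] by (intro add_mono mult_left_mono) auto
        moreover have "e * w i \<le> e * 1" using e w by (intro mult_left_mono) auto
        moreover have "0 \<le> e * w i" using e w by simp
        ultimately show ?thesis by simp
      qed
      have "free_energy d X (\<lambda>i. s i + e * v i) - K * (e * sqrt e) \<le> free_energy d X (\<lambda>i. s i + e * u i)"
        unfolding K_def k_def
      proof (rule free_energy_step[OF X X0 XW' _ d e[unfolded k_def] s0])
        show "cov (\<lambda>i. e * u i) z z' \<le> cov (\<lambda>i. e * v i) z z'" for z z'
          using mult_left_mono[OF cov[of z z'], of e] e
          by (simp add: cov_def sum_distrib_left mult.assoc)
      qed (use bounds u v in \<open>auto simp: W'_def\<close>)
      moreover have "(\<lambda>i. s i + e * v i) = path j" "(\<lambda>i. s i + e * u i) = path (Suc j)"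
        by (auto simp: fun_eq_iff s_def path_def algebra_simps)
      ultimately show ?thesis by simp
    qed
    have "free_energy d X (path 0) - real j * (K * (e * sqrt e)) \<le> free_energy d X (path j)" if "j \<le> n" for j
      using that
    proof (induction j)
      case (Suc j)
      then show ?case using step[of j] by (simp add: algebra_simps)
    qed simp
    from this[of n] have "free_energy d X (path 0) - real n * (K * (e * sqrt e)) \<le> free_energy d X (path n)" by simp
    moreover have "path 0 = v" "path n = u" using n by (auto simp: path_def e_def fun_eq_iff)
    moreover have "real n * (K * (e * sqrt e)) = K / sqrt (real n)"
      using n by (simp add: e_def real_sqrt_divide)
    ultimately show ?thesis by simp
  qed
  have "(\<lambda>n. free_energy d X v - K / sqrt (real n)) \<longlonglongrightarrow> free_energy d X v - 0"
    by (intro tendsto_diff tendsto_const) real_asymp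
  moreover have "eventually (\<lambda>n. free_energy d X v - K / sqrt (real n) \<le> free_energy d X u) sequentially"
    using eventually_ge_at_top[of "max 1 (nat \<lceil>6 * k\<rceil>)"]
    by eventually_elim (intro approx; linarith)
  ultimately show ?thesis
    using tendsto_upperbound by fastforce
qed

end

section \<open>The model\<close>

lemma gauss_vec_eq: "gauss_vec N = std_gauss {..<N}"
  by (simp add: gauss_vec_def std_gauss_def)

lemma disorder_eq: "disorder N = std_gauss ({..<N} \<times> {..<N})"
  by (simp add: disorder_def std_gauss_def)

section \<open>Reindexing and splitting of Gaussian vectors\<close>

lemma measurable_std_gauss_reindex:
  assumes "t \<in> I \<rightarrow> K"
  shows "(\<lambda>\<omega>. \<lambda>n\<in>I. \<omega> (t n)) \<in> std_gauss K \<rightarrow>\<^sub>M std_gauss I"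
  unfolding std_gauss_def using assms
  by (intro measurable_restrict measurable_component_singleton) auto

lemma distr_std_gauss_reindex:
  assumes "inj_on t I" "t \<in> I \<rightarrow> K"
  shows "distr (std_gauss K) (std_gauss I) (\<lambda>\<omega>. \<lambda>n\<in>I. \<omega> (t n)) = std_gauss I"
  using distr_PiM_reindex[OF prob_space_std_normal assms] unfolding std_gauss_def by simp

lemma integral_std_gauss_reindex:
  assumes "inj_on t I" "t \<in> I \<rightarrow> K" and f: "f \<in> borel_measurable (std_gauss I)"
  shows "(\<integral>\<omega>. f (\<lambda>n\<in>I. \<omega> (t n)) \<partial>std_gauss K) = (\<integral>x. f x \<partial>std_gauss I :: real)"
  using integral_distr[OF measurable_std_gauss_reindex[OF assms(2)] f]
  by (simp add: distr_std_gauss_reindex[OF assms(1,2)])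

text \<open>Independence of the first \<open>m\<close> and the last \<open>n\<close> coordinates,
  with the second block moved back to indices starting at zero. Boundedness supplies integrability
  of the product; it is available because, for fixed disorder, the Hamiltonian is bounded
  above.\<close>

lemma integral_std_gauss_split:
  fixes f g :: "(nat \<Rightarrow> real) \<Rightarrow> real"
  assumes f: "f \<in> borel_measurable (std_gauss {..<m})" and g: "g \<in> borel_measurable (std_gauss {..<n})"
    and fb: "\<And>x. \<bar>f x\<bar> \<le> a" and gb: "\<And>x. \<bar>g x\<bar> \<le> b"
  shows "(\<integral>z. f (\<lambda>i\<in>{..<m}. z i) * g (\<lambda>i\<in>{..<n}. z (m + i)) \<partial>std_gauss {..<m + n})
      = (\<integral>x. f x \<partial>std_gauss {..<m}) * (\<integral>y. g y \<partial>std_gauss {..<n})"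
proof -
  interpret N: prob_space std_normal_distribution by (rule prob_space_std_normal)
  interpret P: product_sigma_finite "\<lambda>_::nat. std_normal_distribution" ..
  interpret G: prob_space "std_gauss {..<m + n}" by (rule prob_space_std_gauss)
  let ?J = "{m..<m + n}"
  let ?F = "\<lambda>z. f (\<lambda>i\<in>{..<m}. z i) * g (\<lambda>i\<in>{..<n}. z (m + i))"
  have IJ: "{..<m} \<union> ?J = {..<m + n}" "{..<m} \<inter> ?J = {}" by auto
  have mf: "(\<lambda>z. f (\<lambda>i\<in>{..<m}. z i)) \<in> borel_measurable (std_gauss {..<m + n})"
    by (rule measurable_compose[OF measurable_std_gauss_reindex f]) auto
  have mg: "(\<lambda>z. g (\<lambda>i\<in>{..<n}. z (m + i))) \<in> borel_measurable (std_gauss {..<m + n})"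
    by (rule measurable_compose[OF measurable_std_gauss_reindex g]) auto
  have "integrable (std_gauss {..<m + n}) ?F"
  proof (rule G.integrable_const_bound[where B="a * b"])
    show "AE z in std_gauss {..<m + n}. norm (?F z) \<le> a * b"
      using fb gb order_trans[OF abs_ge_zero fb] by (intro AE_I2) (auto simp: abs_mult intro!: mult_mono)
    show "?F \<in> borel_measurable (std_gauss {..<m + n})" using mf mg by measurable
  qed
  then have "(\<integral>z. ?F z \<partial>std_gauss {..<m + n})
      = (\<integral>x. \<integral>y. ?F (merge {..<m} ?J (x, y)) \<partial>std_gauss ?J \<partial>std_gauss {..<m})"
    unfolding std_gauss_def IJ(1)[symmetric]
    by (intro P.product_integral_fold) (auto simp: IJ)
  also have "\<dots> = (\<integral>x. \<integral>y. f x * g (\<lambda>i\<in>{..<n}. y (m + i)) \<partial>std_gauss ?J \<partial>std_gauss {..<m})"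
  proof (intro Bochner_Integration.integral_cong refl)
    fix x y assume "x \<in> space (std_gauss {..<m})"
    then have "(\<lambda>i\<in>{..<m}. merge {..<m} ?J (x, y) i) = x"
      by (auto simp: std_gauss_def space_PiM merge_def fun_eq_iff PiE_iff extensional_def)
    moreover have "(\<lambda>i\<in>{..<n}. merge {..<m} ?J (x, y) (m + i)) = (\<lambda>i\<in>{..<n}. y (m + i))"
      by (auto simp: merge_def fun_eq_iff)
    ultimately show "?F (merge {..<m} ?J (x, y)) = f x * g (\<lambda>i\<in>{..<n}. y (m + i))" by simp
  qed
  also have "\<dots> = (\<integral>x. f x * (\<integral>y. g y \<partial>std_gauss {..<n}) \<partial>std_gauss {..<m})"
    by (simp add: integral_std_gauss_reindex[of "\<lambda>i. m + i", OF _ _ g] inj_on_def)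
  finally show ?thesis by simp
qed

section \<open>Cubes and a priori bounds for the Hamiltonian\<close>

definition cube :: "nat \<Rightarrow> real \<Rightarrow> (nat \<Rightarrow> real) set" where
  "cube N R = {z. \<forall>i<N. \<bar>z i\<bar> \<le> R}"

text \<open>The product form reduces both measurability and the mass of a cube to one
  coordinate.\<close>

lemma indicator_cube_eq_prod:
  "indicator (cube N R) z = (\<Prod>i<N. indicator {-R..R} (z i) :: real)"
proof (cases "z \<in> cube N R")
  case True
  then have "indicator {-R..R} (z i) = (1 :: real)" if "i < N" for i
    using that by (auto simp: cube_def abs_le_iff minus_le_iff)
  then show ?thesis using True by simp
next
  case False
  then obtain i where "i < N" "z i \<notin> {-R..R}"
    by (auto simp: cube_def abs_le_iff minus_le_iff)
  then have "\<exists>i\<in>{..<N}. indicator {-R..R} (z i) = (0 :: real)" by force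
  then show ?thesis using False by (simp add: prod_zero)
qed

lemma indicator_cube_measurable [measurable]:
  "(\<lambda>z. indicator (cube N R) z :: real) \<in> borel_measurable (std_gauss {..<N})"
  unfolding indicator_cube_eq_prod by measurable

text \<open>The normal density is strictly positive, so an interval null for the Gaussian would be
  null for Lebesgue measure. This mass is what keeps partition functions away from zero.\<close>

lemma integral_indicator_cube_pos:
  assumes "0 < R"
  shows "0 < (\<integral>z. indicator (cube N R) z \<partial>std_gauss {..<N} :: real)"
proof -
  let ?N = std_normal_distribution
  interpret N: prob_space ?N by (rule prob_space_std_normal)
  interpret P: product_sigma_finite "\<lambda>_::nat. ?N" ..
  have "0 < measure ?N {-R..R}"
  proof (rule ccontr)
    assume "\<not> 0 < measure ?N {-R..R}"
    then have "emeasure ?N {-R..R} = 0"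
      by (simp add: N.emeasure_eq_measure zero_less_measure_iff)
    then have "AE x in ?N. x \<notin> {-R..R}"
      by (intro AE_not_in) (auto simp: null_sets_def)
    then have "AE x in lborel. x \<notin> {-R..R}"
      by (subst (asm) AE_density) (auto simp: normal_density_pos)
    then have "emeasure lborel {-R..R} = 0"
      by (subst (asm) AE_iff_measurable[where N="{-R..R}"]) auto
    then show False using assms by simp
  qed
  moreover have "(\<integral>z. indicator (cube N R) z \<partial>std_gauss {..<N} :: real) = (\<Prod>i<N. measure ?N {-R..R})"
    unfolding indicator_cube_eq_prod std_gauss_def
    by (subst P.product_integral_prod) (auto intro!: N.emeasure_finite simp: less_top[symmetric])
  ultimately show ?thesis by (simp add: prod_pos)
qed

definition disorder_sq :: "nat \<Rightarrow> (nat \<times> nat \<Rightarrow> real) \<Rightarrow> real" where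
  "disorder_sq N J = (\<Sum>i<N. \<Sum>j<N. (J (i, j))\<^sup>2)"

lemma disorder_sq_nonneg: "0 \<le> disorder_sq N J"
  unfolding disorder_sq_def by (intro sum_nonneg) auto

text \<open>From \<open>x\<^sup>2 \<le> 2 * exp \<bar>x\<bar>\<close>. A multiple of
  \<open>1 + disorder_sq N J\<close> is the dominating function for all logarithms of partition
  functions below.\<close>

lemma integrable_disorder_sq: "integrable (disorder N) (disorder_sq N)"
proof -
  let ?I = "{..<N} \<times> {..<N}"
  have "integrable (std_gauss ?I) (\<lambda>J. (J p)\<^sup>2)" if p: "p \<in> ?I" for p
  proof (rule Bochner_Integration.integrable_bound)
    show "integrable (std_gauss ?I) (\<lambda>J. 2 * exp (1 * (\<Sum>p\<in>?I. \<bar>J p\<bar>)))"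
      by (intro integrable_mult_right integrable_std_gauss_exp_abs) auto
    show "(\<lambda>J. (J p)\<^sup>2) \<in> borel_measurable (std_gauss ?I)" using p by measurable
    show "AE J in std_gauss ?I. norm ((J p)\<^sup>2) \<le> norm (2 * exp (1 * (\<Sum>p\<in>?I. \<bar>J p\<bar>)))"
    proof (intro AE_I2)
      fix J :: "nat \<times> nat \<Rightarrow> real"
      have "1 + \<bar>J p\<bar> + \<bar>J p\<bar>\<^sup>2 / 2 \<le> exp \<bar>J p\<bar>"
        by (rule exp_lower_Taylor_quadratic) simp
      also have "\<dots> \<le> exp (\<Sum>p\<in>?I. \<bar>J p\<bar>)"
        unfolding exp_le_cancel_iff by (rule member_le_sum[OF p]) auto
      finally show "norm ((J p)\<^sup>2) \<le> norm (2 * exp (1 * (\<Sum>p\<in>?I. \<bar>J p\<bar>)))" by simp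
    qed
  qed
  then show ?thesis
    unfolding disorder_eq disorder_sq_def[abs_def] by (intro Bochner_Integration.integrable_sum) auto
qed

lemma hamiltonian_exponent_cong:
  assumes "\<And>i j. i < N \<Longrightarrow> j < N \<Longrightarrow> J (i, j) = J' (i, j)" "\<And>i. i < N \<Longrightarrow> z i = z' i"
  shows "hamiltonian_exponent N \<beta> lam h J z = hamiltonian_exponent N \<beta> lam h J' z'"
proof -
  have "(\<Sum>i<N. \<Sum>j<N. J (i, j) * z i * z j) = (\<Sum>i<N. \<Sum>j<N. J' (i, j) * z' i * z' j)"
    "(\<Sum>i<N. z i) = (\<Sum>i<N. z' i)" "(\<Sum>i<N. (z i)\<^sup>2) = (\<Sum>i<N. (z' i)\<^sup>2)"
    using assms by (auto intro!: sum.cong)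
  then show ?thesis unfolding hamiltonian_exponent_def by simp
qed

text \<open>The negative quartic term controls the disorder, the field and the quadratic term at
  once, at a cost of order \<open>disorder_sq\<close>. From below no uniform bound in
  \<open>z\<close> can hold, but on the unit cube every sum over \<open>z\<close> is bounded, which
  is enough for a lower bound on the partition function.\<close>

lemma hamiltonian_exponent_bounds:
  assumes "\<beta> > 0" "N \<ge> 1"
  obtains C where "0 \<le> C"
    "\<And>J z. hamiltonian_exponent N \<beta> lam h J z \<le> C + disorder_sq N J"
    "\<And>J z. z \<in> cube N 1 \<Longrightarrow> - (C * (1 + disorder_sq N J)) \<le> hamiltonian_exponent N \<beta> lam h J z"
proof -
  have minus_abs_le: "- \<bar>x\<bar> \<le> x" for x :: real by (simp add: abs_if)
  define \<kappa> where "\<kappa> = \<beta> / sqrt (2 * real N)"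
  \<comment> \<open>The quartic coefficient is \<open>2 * b\<close>. One half of it pays for the
    disorder, by \<open>\<kappa> * J * y \<le> J\<^sup>2 + \<kappa>\<^sup>2 / 4 * y\<^sup>2\<close>
    with \<open>\<kappa>\<^sup>2 / 4 = b\<close>; the other half pays for \<open>a * q\<close>,
    where \<open>a\<close> collects \<open>1 / 2\<close> from the field term and
    \<open>lam / 2\<close>.\<close>
  define a where "a = (1 + lam) / 2"
  define b where "b = \<beta>\<^sup>2 / (8 * real N)"
  have b: "0 < b" using assms by (simp add: b_def)
  have \<kappa>: "0 < \<kappa>" "\<kappa>\<^sup>2 = 4 * b" using assms by (auto simp: \<kappa>_def b_def power_divide)
  define C0 where "C0 = real N * (\<beta> * h)\<^sup>2 / 2 + a\<^sup>2 / (4 * b)"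
  define C1 where "C1 = \<kappa> * (real N)\<^sup>2 + \<kappa> + \<bar>\<beta> * h\<bar> * real N + 2 * b * (real N)\<^sup>2 + \<bar>lam\<bar> / 2 * real N"
  have C0: "0 \<le> C0" and C1: "0 \<le> C1" using b \<kappa> by (auto simp: C0_def C1_def intro!: add_nonneg_nonneg)
  have H: "hamiltonian_exponent N \<beta> lam h J z = \<kappa> * (\<Sum>i<N. \<Sum>j<N. J (i, j) * z i * z j)
     + \<beta> * h * (\<Sum>i<N. z i) - 2 * b * (\<Sum>i<N. (z i)\<^sup>2)\<^sup>2 + lam / 2 * (\<Sum>i<N. (z i)\<^sup>2)" for J z
    unfolding hamiltonian_exponent_def \<kappa>_def b_def by simp
  have upper: "hamiltonian_exponent N \<beta> lam h J z \<le> C0 + disorder_sq N J" for J z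
  proof -
    define q where "q = (\<Sum>i<N. (z i)\<^sup>2)"
    have "\<kappa> * (\<Sum>i<N. \<Sum>j<N. J (i, j) * z i * z j) = (\<Sum>i<N. \<Sum>j<N. \<kappa> * (J (i, j) * z i * z j))"
      by (simp add: sum_distrib_left)
    also have "\<dots> \<le> (\<Sum>i<N. \<Sum>j<N. (J (i, j))\<^sup>2 + b * ((z i)\<^sup>2 * (z j)\<^sup>2))"
    proof (intro sum_mono)
      fix i j
      have "0 \<le> (J (i, j) - \<kappa> / 2 * (z i * z j))\<^sup>2" by simp
      also have "\<dots> = (J (i, j))\<^sup>2 + \<kappa>\<^sup>2 / 4 * ((z i)\<^sup>2 * (z j)\<^sup>2) - \<kappa> * (J (i, j) * z i * z j)"
        by (simp add: power2_diff power_mult_distrib power_divide)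
      finally show "\<kappa> * (J (i, j) * z i * z j) \<le> (J (i, j))\<^sup>2 + b * ((z i)\<^sup>2 * (z j)\<^sup>2)"
        using \<kappa>(2) by simp
    qed
    also have "\<dots> = disorder_sq N J + b * q\<^sup>2"
    proof -
      have "q\<^sup>2 = (\<Sum>i<N. \<Sum>j<N. (z i)\<^sup>2 * (z j)\<^sup>2)"
        unfolding q_def power2_eq_square[of "sum _ _"] sum_product ..
      then show ?thesis by (simp add: sum.distrib disorder_sq_def sum_distrib_left)
    qed
    finally have 1: "\<kappa> * (\<Sum>i<N. \<Sum>j<N. J (i, j) * z i * z j) \<le> disorder_sq N J + b * q\<^sup>2" .
    have "\<beta> * h * (\<Sum>i<N. z i) = (\<Sum>i<N. \<beta> * h * z i)" by (simp add: sum_distrib_left)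
    also have "\<dots> \<le> (\<Sum>i<N. (\<beta> * h)\<^sup>2 / 2 + (z i)\<^sup>2 / 2)"
    proof (rule sum_mono)
      fix i
      have "0 \<le> (\<beta> * h - z i)\<^sup>2" by simp
      then show "\<beta> * h * z i \<le> (\<beta> * h)\<^sup>2 / 2 + (z i)\<^sup>2 / 2" by (simp add: power2_diff)
    qed
    also have "\<dots> = real N * (\<beta> * h)\<^sup>2 / 2 + q / 2"
      by (simp add: sum.distrib q_def sum_divide_distrib)
    finally have 2: "\<beta> * h * (\<Sum>i<N. z i) \<le> real N * (\<beta> * h)\<^sup>2 / 2 + q / 2" .
    \<comment> \<open>Completing the square in \<open>q\<close> bounds
      \<open>a * q - b * q\<^sup>2\<close> by its maximum.\<close>
    have "0 \<le> (2 * b * q - a)\<^sup>2 / (4 * b)" using b by simp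
    also have "\<dots> = b * q\<^sup>2 - a * q + a\<^sup>2 / (4 * b)"
      using b by (simp add: power2_diff power_mult_distrib divide_simps) (simp add: algebra_simps power2_eq_square)
    finally have 3: "a * q - b * q\<^sup>2 \<le> a\<^sup>2 / (4 * b)" by simp
    have "q / 2 + lam / 2 * q = a * q" by (simp add: a_def field_simps)
    then show ?thesis using 1 2 3 unfolding H C0_def q_def[symmetric] by linarith
  qed
  have lower: "- (C1 * (1 + disorder_sq N J)) \<le> hamiltonian_exponent N \<beta> lam h J z"
    if z: "z \<in> cube N 1" for J z
  proof -
    define q where "q = (\<Sum>i<N. (z i)\<^sup>2)"
    have z1: "\<bar>z i\<bar> \<le> 1" if "i < N" for i using z that by (simp add: cube_def)
    have "\<bar>\<Sum>i<N. \<Sum>j<N. J (i, j) * z i * z j\<bar> \<le> (\<Sum>i<N. \<Sum>j<N. \<bar>J (i, j) * z i * z j\<bar>)"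
      by (rule order_trans[OF sum_abs sum_mono]) (rule sum_abs)
    also have "\<dots> \<le> (\<Sum>i<N. \<Sum>j<N. 1 + (J (i, j))\<^sup>2)"
    proof (intro sum_mono)
      fix i j assume "i \<in> {..<N}" "j \<in> {..<N}"
      then have "\<bar>J (i, j)\<bar> * (\<bar>z i\<bar> * \<bar>z j\<bar>) \<le> \<bar>J (i, j)\<bar> * (1 * 1)"
        using z1 by (intro mult_left_mono mult_mono) auto
      moreover have "0 \<le> (\<bar>J (i, j)\<bar> - 1)\<^sup>2" by simp
      then have "2 * \<bar>J (i, j)\<bar> \<le> 1 + (J (i, j))\<^sup>2" by (simp add: power2_diff)
      ultimately show "\<bar>J (i, j) * z i * z j\<bar> \<le> 1 + (J (i, j))\<^sup>2" by (simp add: abs_mult)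
    qed
    also have "\<dots> = (real N)\<^sup>2 + disorder_sq N J"
      by (simp add: sum.distrib disorder_sq_def power2_eq_square)
    finally have "\<kappa> * \<bar>\<Sum>i<N. \<Sum>j<N. J (i, j) * z i * z j\<bar> \<le> \<kappa> * ((real N)\<^sup>2 + disorder_sq N J)"
      using \<kappa> by (intro mult_left_mono) auto
    then have 1: "- (\<kappa> * (real N)\<^sup>2 + \<kappa> * disorder_sq N J) \<le> \<kappa> * (\<Sum>i<N. \<Sum>j<N. J (i, j) * z i * z j)"
      using mult_left_mono[OF minus_abs_le, of \<kappa> "\<Sum>i<N. \<Sum>j<N. J (i, j) * z i * z j"] \<kappa>
      unfolding distrib_left by linarith
    have "\<bar>\<Sum>i<N. z i\<bar> \<le> (\<Sum>i<N. \<bar>z i\<bar>)" by (rule sum_abs)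
    also have "\<dots> \<le> (\<Sum>i<N. 1)" using z1 by (intro sum_mono) auto
    finally have "\<bar>\<beta> * h\<bar> * \<bar>\<Sum>i<N. z i\<bar> \<le> \<bar>\<beta> * h\<bar> * real N"
      by (intro mult_left_mono) auto
    then have 2: "- (\<bar>\<beta> * h\<bar> * real N) \<le> \<beta> * h * (\<Sum>i<N. z i)"
      using minus_abs_le[of "\<beta> * h * (\<Sum>i<N. z i)"] by (simp only: abs_mult)
    have q0: "0 \<le> q" unfolding q_def by (intro sum_nonneg) auto
    have "q \<le> (\<Sum>i<N. 1)" unfolding q_def using z1 by (intro sum_mono) (auto simp: abs_square_le_1)
    then have qN: "q \<le> real N" by simp
    have 3: "2 * b * q\<^sup>2 \<le> 2 * b * (real N)\<^sup>2"
      using b q0 qN by (intro mult_left_mono power_mono) auto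
    have "\<bar>lam\<bar> / 2 * q \<le> \<bar>lam\<bar> / 2 * real N" using qN by (intro mult_left_mono) auto
    moreover have "- (\<bar>lam\<bar> / 2 * q) \<le> lam / 2 * q"
      using mult_right_mono[of "-\<bar>lam\<bar>" lam q] q0 by auto
    ultimately have 4: "- (\<bar>lam\<bar> / 2 * real N) \<le> lam / 2 * q" by linarith
    have "\<kappa> * (real N)\<^sup>2 + \<kappa> * disorder_sq N J + \<bar>\<beta> * h\<bar> * real N + 2 * b * (real N)\<^sup>2 + \<bar>lam\<bar> / 2 * real N
        \<le> C1 + C1 * disorder_sq N J"
    proof -
      have "\<kappa> \<le> C1" unfolding C1_def using b \<kappa> by (auto intro!: add_nonneg_nonneg)
      then have "\<kappa> * disorder_sq N J \<le> C1 * disorder_sq N J"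
        using disorder_sq_nonneg by (rule mult_right_mono)
      moreover have "\<kappa> * (real N)\<^sup>2 + \<bar>\<beta> * h\<bar> * real N + 2 * b * (real N)\<^sup>2 + \<bar>lam\<bar> / 2 * real N \<le> C1"
        unfolding C1_def using \<kappa> by simp
      ultimately show ?thesis by linarith
    qed
    then show ?thesis using 1 2 3 4 unfolding H q_def[symmetric] distrib_left by linarith
  qed
  show thesis
  proof (rule that[of "C0 + C1"])
    show "0 \<le> C0 + C1" using C0 C1 by simp
    show "hamiltonian_exponent N \<beta> lam h J z \<le> C0 + C1 + disorder_sq N J" for J z
      using upper[of J z] C1 by linarith
    show "- ((C0 + C1) * (1 + disorder_sq N J)) \<le> hamiltonian_exponent N \<beta> lam h J z"
      if "z \<in> cube N 1" for J z
    proof -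
      have "0 \<le> C0 * (1 + disorder_sq N J)" using C0 disorder_sq_nonneg[of N J] by simp
      then show ?thesis using lower[OF that, of J] by (simp add: distrib_right)
    qed
  qed
qed

section \<open>Sums over two blocks of indices\<close>

lemma sum_lessThan_add:
  fixes f :: "nat \<Rightarrow> 'a::comm_monoid_add"
  shows "(\<Sum>i<m + n. f i) = (\<Sum>i<m. f i) + (\<Sum>i<n. f (m + i))"
  by (induction n) (simp_all add: add.assoc)

text \<open>The conditional has the shape of the decoupled variance profile, so sums weighted by
  that profile reduce to the two diagonal blocks.\<close>

lemma sum_diagonal_blocks:
  fixes a b :: "nat \<times> nat \<Rightarrow> real"
  shows "(\<Sum>p\<in>{..<m + n} \<times> {..<m + n}. if fst p < m \<and> snd p < m then a p
            else if m \<le> fst p \<and> m \<le> snd p then b p else 0)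
       = (\<Sum>i<m. \<Sum>j<m. a (i, j)) + (\<Sum>i<n. \<Sum>j<n. b (m + i, m + j))"
proof -
  have "(\<Sum>p\<in>{..<m + n} \<times> {..<m + n}. if fst p < m \<and> snd p < m then a p
            else if m \<le> fst p \<and> m \<le> snd p then b p else 0)
      = (\<Sum>i<m + n. \<Sum>j<m + n. if i < m \<and> j < m then a (i, j) else if m \<le> i \<and> m \<le> j then b (i, j) else 0)"
    unfolding sum.cartesian_product by (intro sum.cong refl) auto
  then show ?thesis by (simp add: sum_lessThan_add sum.distrib)
qed

lemma sum_square_eq_double_sum:
  fixes f :: "nat \<Rightarrow> real"
  shows "(\<Sum>i<n. \<Sum>j<n. f i * f j) = (\<Sum>i<n. f i)\<^sup>2"
  by (simp add: power2_eq_square sum_product)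

lemma all_less_add: "(\<forall>i<m + n. P i) \<longleftrightarrow> (\<forall>i<m. P i) \<and> (\<forall>i<n. P (m + i))" for m n :: nat
proof (intro iffI conjI allI impI)
  fix i assume "(\<forall>i<m. P i) \<and> (\<forall>i<n. P (m + i))" "i < m + n"
  then show "P i" by (cases "i < m") (auto dest: spec[of _ "i - m"])
qed auto

section \<open>Partition functions with a weight and bounds on their logarithms uniform in the
  weight\<close>

definition weighted_partition ::
  "nat \<Rightarrow> real \<Rightarrow> real \<Rightarrow> real \<Rightarrow> ((nat \<Rightarrow> real) \<Rightarrow> real) \<Rightarrow> (nat \<times> nat \<Rightarrow> real) \<Rightarrow> real" where
  "weighted_partition N \<beta> lam h w J =
     (\<integral>z. w z * exp (hamiltonian_exponent N \<beta> lam h J z) \<partial>gauss_vec N)"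

lemma partition_fn_eq_weighted: "partition_fn N \<beta> lam h J = weighted_partition N \<beta> lam h (\<lambda>_. 1) J"
  by (simp add: partition_fn_def weighted_partition_def)

lemma weighted_partition_cong:
  assumes "\<And>i j. i < N \<Longrightarrow> j < N \<Longrightarrow> J (i, j) = J' (i, j)"
  shows "weighted_partition N \<beta> lam h w J = weighted_partition N \<beta> lam h w J'"
  unfolding weighted_partition_def
  by (intro Bochner_Integration.integral_cong refl arg_cong2[where f="(*)"] arg_cong[where f=exp]
      hamiltonian_exponent_cong assms)

lemma hamiltonian_exponent_measurable [measurable]:
  "(\<lambda>z. hamiltonian_exponent N \<beta> lam h J z) \<in> borel_measurable (gauss_vec N)"
  unfolding hamiltonian_exponent_def gauss_vec_eq by measurable

lemma weighted_partition_measurable: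
  assumes w: "w \<in> borel_measurable (gauss_vec N)"
  shows "weighted_partition N \<beta> lam h w \<in> borel_measurable (disorder N)"
proof -
  interpret prob_space "gauss_vec N" unfolding gauss_vec_eq by (rule prob_space_std_gauss)
  note [measurable] = w[unfolded gauss_vec_eq]
  have "(\<lambda>p. w (snd p) * exp (hamiltonian_exponent N \<beta> lam h (fst p) (snd p)))
      \<in> borel_measurable (disorder N \<Otimes>\<^sub>M gauss_vec N)"
    unfolding hamiltonian_exponent_def disorder_eq gauss_vec_eq by measurable
  then show ?thesis
    unfolding weighted_partition_def[abs_def]
    by (intro borel_measurable_lebesgue_integral) (simp add: split_beta')
qed

lemma integrable_weighted_partition:
  assumes "\<beta> > 0" "N \<ge> 1"
    and w: "w \<in> borel_measurable (gauss_vec N)" "\<And>z. 0 \<le> w z" "\<And>z. w z \<le> 1"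
  shows "integrable (gauss_vec N) (\<lambda>z. w z * exp (hamiltonian_exponent N \<beta> lam h J z))"
proof -
  interpret prob_space "gauss_vec N" unfolding gauss_vec_eq by (rule prob_space_std_gauss)
  note [measurable] = w(1)
  obtain C where C: "\<And>J z. hamiltonian_exponent N \<beta> lam h J z \<le> C + disorder_sq N J"
    using hamiltonian_exponent_bounds[OF assms(1,2)] by metis
  show ?thesis
  proof (rule integrable_const_bound[where B="exp (C + disorder_sq N J)"])
    show "AE z in gauss_vec N. norm (w z * exp (hamiltonian_exponent N \<beta> lam h J z)) \<le> exp (C + disorder_sq N J)"
    proof (intro AE_I2)
      fix z
      have "w z * exp (hamiltonian_exponent N \<beta> lam h J z) \<le> 1 * exp (C + disorder_sq N J)"
        using w C by (intro mult_mono) auto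
      then show "norm (w z * exp (hamiltonian_exponent N \<beta> lam h J z)) \<le> exp (C + disorder_sq N J)"
        using w by (simp add: abs_mult)
    qed
  qed measurable
qed

text \<open>One constant serves all weights and shifts, so a single dominating function covers every
  cutoff and its limit. A weight above the unit-cube indicator gives the lower bound, a weight of at
  most one gives the upper bound. The value \<open>d = 0\<close> yields the bound for the true
  logarithm, and \<open>d = 1\<close> is used for the decoupled product.\<close>

lemma ln_weighted_partition_bound:
  assumes "\<beta> > 0" "N \<ge> 1"
  obtains C where "0 \<le> C"
    "\<And>w d J. w \<in> borel_measurable (gauss_vec N) \<Longrightarrow> (\<And>z. indicator (cube N 1) z \<le> w z) \<Longrightarrow>
       (\<And>z. w z \<le> 1) \<Longrightarrow> 0 \<le> d \<Longrightarrow> d \<le> 1 \<Longrightarrow>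
       0 < weighted_partition N \<beta> lam h w J \<and>
       \<bar>ln (d + weighted_partition N \<beta> lam h w J)\<bar> \<le> C * (1 + disorder_sq N J)"
proof -
  interpret prob_space "gauss_vec N" unfolding gauss_vec_eq by (rule prob_space_std_gauss)
  obtain C where C: "0 \<le> C" "\<And>J z. hamiltonian_exponent N \<beta> lam h J z \<le> C + disorder_sq N J"
    "\<And>J z. z \<in> cube N 1 \<Longrightarrow> - (C * (1 + disorder_sq N J)) \<le> hamiltonian_exponent N \<beta> lam h J z"
    using hamiltonian_exponent_bounds[OF assms] by blast
  define p where "p = (\<integral>z. indicator (cube N 1) z \<partial>gauss_vec N :: real)"
  have p: "0 < p" unfolding p_def gauss_vec_eq by (rule integral_indicator_cube_pos) simp
  define K where "K = \<bar>ln p\<bar> + ln 2 + C + 1"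
  have K: "0 \<le> K" using C by (simp add: K_def add_nonneg_nonneg)
  have "0 < weighted_partition N \<beta> lam h w J \<and>
       \<bar>ln (d + weighted_partition N \<beta> lam h w J)\<bar> \<le> K * (1 + disorder_sq N J)"
    if w: "w \<in> borel_measurable (gauss_vec N)" and w1: "\<And>z. indicator (cube N 1) z \<le> w z"
      "\<And>z. w z \<le> 1" and d: "0 \<le> d" "d \<le> 1" for w d J
  proof -
    let ?Z = "weighted_partition N \<beta> lam h w J"
    let ?S = "disorder_sq N J"
    note [measurable] = w
    have S: "0 \<le> ?S" by (rule disorder_sq_nonneg)
    have w0: "0 \<le> w z" for z using w1(1)[of z] by (rule order_trans[rotated]) simp
    note int = integrable_weighted_partition[OF assms w w0 w1(2), of lam h J]
    have intc: "integrable (gauss_vec N) (\<lambda>z. indicator (cube N 1) z :: real)"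
      by (rule integrable_const_bound[where B=1]) (auto simp: gauss_vec_eq)
    have "p * exp (- (C * (1 + ?S))) = (\<integral>z. indicator (cube N 1) z * exp (- (C * (1 + ?S))) \<partial>gauss_vec N)"
      unfolding p_def by simp
    also have "\<dots> \<le> ?Z"
      unfolding weighted_partition_def
    proof (rule integral_mono[OF _ int])
      fix z
      show "indicator (cube N 1) z * exp (- (C * (1 + ?S))) \<le> w z * exp (hamiltonian_exponent N \<beta> lam h J z)"
      proof (cases "z \<in> cube N 1")
        case True
        then show ?thesis using w1(1)[of z] C(3)[OF True, of J] w0 by (intro mult_mono) auto
      qed (use w0 in simp)
    qed (use intc in simp)
    finally have lo: "p * exp (- (C * (1 + ?S))) \<le> ?Z" .
    have "?Z \<le> (\<integral>z. exp (C + ?S) \<partial>gauss_vec N)"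
      unfolding weighted_partition_def
    proof (rule integral_mono[OF int])
      fix z
      have "w z * exp (hamiltonian_exponent N \<beta> lam h J z) \<le> 1 * exp (C + ?S)"
        using w0 w1 C by (intro mult_mono) auto
      then show "w z * exp (hamiltonian_exponent N \<beta> lam h J z) \<le> exp (C + ?S)" by simp
    qed simp
    then have up: "?Z \<le> exp (C + ?S)" by (simp add: prob_space)
    have pos: "0 < ?Z" using lo p by (meson exp_gt_zero less_le_trans mult_pos_pos)
    have "ln p - C * (1 + ?S) = ln (p * exp (- (C * (1 + ?S))))"
      using p by (simp add: ln_mult_pos)
    also have "\<dots> \<le> ln (d + ?Z)"
      using lo p d pos by (subst ln_le_cancel_iff) (auto intro: add_nonneg_pos)
    finally have 1: "ln p - C * (1 + ?S) \<le> ln (d + ?Z)" .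
    have "d + ?Z \<le> 2 * exp (C + ?S)"
      using up d C S one_le_exp_iff[of "C + ?S"] by linarith
    then have "ln (d + ?Z) \<le> ln (2 * exp (C + ?S))"
      using d pos by (subst ln_le_cancel_iff) (auto intro: add_nonneg_pos)
    also have "\<dots> = ln 2 + C + ?S" by (simp add: ln_mult_pos)
    finally have 2: "ln (d + ?Z) \<le> ln 2 + C + ?S" .
    have "K * (1 + ?S) = \<bar>ln p\<bar> + ln 2 + C * (1 + ?S) + 1 + ?S + (\<bar>ln p\<bar> + ln 2) * ?S"
      unfolding K_def by (simp add: algebra_simps)
    moreover have "0 \<le> (\<bar>ln p\<bar> + ln 2) * ?S" "0 \<le> C * ?S" using S C by auto
    moreover have "0 \<le> ln (2 :: real)" by simp
    ultimately have "\<bar>ln (d + ?Z)\<bar> \<le> K * (1 + ?S)"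
      using 1 2 S C(1) unfolding distrib_left by linarith
    then show ?thesis using pos by simp
  qed
  then show thesis using that[OF K] by blast
qed

abbreviation cut_partition ::
  "nat \<Rightarrow> real \<Rightarrow> real \<Rightarrow> real \<Rightarrow> real \<Rightarrow> (nat \<times> nat \<Rightarrow> real) \<Rightarrow> real" where
  "cut_partition N \<beta> lam h R \<equiv> weighted_partition N \<beta> lam h (indicator (cube N R))"

lemma indicator_cube_gauss_vec: "(indicator (cube N R) :: _ \<Rightarrow> real) \<in> borel_measurable (gauss_vec N)"
  unfolding gauss_vec_eq by (rule indicator_cube_measurable)

lemma cut_partition_tendsto:
  assumes "\<beta> > 0" "N \<ge> 1"
  shows "(\<lambda>n. cut_partition N \<beta> lam h (real (Suc n)) J) \<longlonglongrightarrow> partition_fn N \<beta> lam h J"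
  unfolding partition_fn_def weighted_partition_def
proof (rule integral_dominated_convergence[where w="\<lambda>z. exp (hamiltonian_exponent N \<beta> lam h J z)"])
  show "integrable (gauss_vec N) (\<lambda>z. exp (hamiltonian_exponent N \<beta> lam h J z))"
    using integrable_weighted_partition[OF assms, of "\<lambda>_. 1" lam h J] by simp
  show "AE z in gauss_vec N. (\<lambda>n. indicator (cube N (real (Suc n))) z * exp (hamiltonian_exponent N \<beta> lam h J z))
      \<longlonglongrightarrow> exp (hamiltonian_exponent N \<beta> lam h J z)"
  proof (intro AE_I2 tendsto_eventually)
    fix z :: "nat \<Rightarrow> real"
    show "eventually (\<lambda>n. indicator (cube N (real (Suc n))) z * exp (hamiltonian_exponent N \<beta> lam h J z)
        = exp (hamiltonian_exponent N \<beta> lam h J z)) sequentially"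
      using eventually_ge_at_top[of "nat \<lceil>\<Sum>i<N. \<bar>z i\<bar>\<rceil>"]
    proof eventually_elim
      case (elim n)
      have "\<bar>z i\<bar> \<le> real (Suc n)" if "i < N" for i
      proof -
        have "\<bar>z i\<bar> \<le> (\<Sum>i<N. \<bar>z i\<bar>)" using that by (intro member_le_sum) auto
        then show ?thesis using elim by linarith
      qed
      then show ?case by (simp add: cube_def)
    qed
  qed
  show "AE z in gauss_vec N. norm (indicator (cube N (real (Suc n))) z * exp (hamiltonian_exponent N \<beta> lam h J z))
      \<le> exp (hamiltonian_exponent N \<beta> lam h J z)" for n
    by (intro AE_I2) (auto simp: indicator_def)
  show "(\<lambda>z. indicator (cube N (real (Suc n))) z * exp (hamiltonian_exponent N \<beta> lam h J z))
      \<in> borel_measurable (gauss_vec N)" for n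
    using indicator_cube_gauss_vec[of N "real (Suc n)"] by measurable
qed measurable

text \<open>With coefficients \<open>\<beta> / sqrt 2 * z i * z j\<close> and variance
  \<open>1 / N\<close> on each ordered pair, the half variance is
  \<open>\<beta>\<^sup>2 / (4 * N)\<close> times the square of the sum of
  \<open>(z i)\<^sup>2\<close>. Diagonal pairs are included, so the double sum is a perfect square
  and matches the quartic term exactly.\<close>

lemma wick_exponent_eq_hamiltonian:
  assumes "N \<ge> 1"
  shows "\<beta> * h * (\<Sum>i<N. z i) + lam / 2 * (\<Sum>i<N. (z i)\<^sup>2)
       + ((\<Sum>i<N. \<Sum>j<N. sqrt (1 / real N) * J (i, j) * (\<beta> / sqrt 2 * z i * z j))
          - (\<Sum>i<N. \<Sum>j<N. 1 / real N * (\<beta> / sqrt 2 * z i * z j)\<^sup>2) / 2)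
     = hamiltonian_exponent N \<beta> lam h J z"
proof -
  have "(\<Sum>i<N. \<Sum>j<N. sqrt (1 / real N) * J (i, j) * (\<beta> / sqrt 2 * z i * z j))
      = \<beta> / sqrt (2 * real N) * (\<Sum>i<N. \<Sum>j<N. J (i, j) * z i * z j)"
    by (simp add: sum_distrib_left real_sqrt_divide real_sqrt_mult field_simps)
  moreover have "(\<Sum>i<N. \<Sum>j<N. 1 / real N * (\<beta> / sqrt 2 * z i * z j)\<^sup>2)
      = \<beta>\<^sup>2 / (2 * real N) * (\<Sum>i<N. (z i)\<^sup>2)\<^sup>2"
    unfolding sum_square_eq_double_sum[symmetric]
    by (simp add: sum_distrib_left power_mult_distrib power_divide mult_ac)
  ultimately show ?thesis unfolding hamiltonian_exponent_def by simp
qed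

text \<open>Convexity of the square with weights \<open>m / (m + n)\<close> and
  \<open>n / (m + n)\<close>. The defect is the explicit square
  \<open>(n * a - m * b)\<^sup>2\<close> over \<open>m * n * (m + n)\<close>.\<close>

lemma square_sum_le:
  fixes a b :: real
  assumes "m \<ge> 1" "n \<ge> 1"
  shows "1 / real (m + n) * (a + b)\<^sup>2 \<le> 1 / real m * a\<^sup>2 + 1 / real n * b\<^sup>2"
proof -
  define m' n' where "m' = real m" and "n' = real n"
  have pos: "0 < m'" "0 < n'" using assms by (auto simp: m'_def n'_def)
  have "1 / m' * a\<^sup>2 + 1 / n' * b\<^sup>2 - 1 / (m' + n') * (a + b)\<^sup>2
      = (n' * a - m' * b)\<^sup>2 / (m' * n' * (m' + n'))"
    using pos by (simp add: divide_simps add_pos_pos) (simp add: algebra_simps power2_eq_square)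
  also have "\<dots> \<ge> 0" using pos by simp
  finally show ?thesis by (simp add: m'_def n'_def)
qed

definition shift_disorder :: "nat \<Rightarrow> (nat \<times> nat \<Rightarrow> real) \<Rightarrow> nat \<times> nat \<Rightarrow> real" where
  "shift_disorder m J = (\<lambda>p. J (m + fst p, m + snd p))"

text \<open>The two Hamiltonians read disjoint sets of coordinates and a cube is a product of cubes,
  so the integral factorises.\<close>

lemma cut_partition_split:
  assumes "\<beta> > 0" "m \<ge> 1" "n \<ge> 1"
  shows "(\<integral>z. indicator (cube (m + n) R) z * exp (hamiltonian_exponent m \<beta> lam h J z
            + hamiltonian_exponent n \<beta> lam h J' (\<lambda>i. z (m + i))) \<partial>gauss_vec (m + n))
       = cut_partition m \<beta> lam h R J * cut_partition n \<beta> lam h R J'"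
proof -
  define f where "f k J z = indicator (cube k R) z * exp (hamiltonian_exponent k \<beta> lam h J z)"
    for k and J :: "nat \<times> nat \<Rightarrow> real" and z
  have meas: "f k J \<in> borel_measurable (std_gauss {..<k})" for k J
    using indicator_cube_gauss_vec[of k R] unfolding f_def[abs_def] gauss_vec_eq[symmetric] by measurable
  have bound: "\<exists>a. \<forall>x. \<bar>f k J x\<bar> \<le> a" if k: "k \<ge> 1" for k J
  proof -
    obtain C where C: "\<And>J z. hamiltonian_exponent k \<beta> lam h J z \<le> C + disorder_sq k J"
      using hamiltonian_exponent_bounds[OF assms(1) k] by metis
    have "\<bar>f k J x\<bar> \<le> exp (C + disorder_sq k J)" for x
      using C[of J x] by (auto simp: f_def indicator_def)
    then show ?thesis by blast
  qed
  obtain a where a: "\<And>x. \<bar>f m J x\<bar> \<le> a" using bound[OF assms(2)] by metis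
  obtain b where b: "\<And>x. \<bar>f n J' x\<bar> \<le> b" using bound[OF assms(3)] by metis
  have "indicator (cube (m + n) R) z * exp (hamiltonian_exponent m \<beta> lam h J z
            + hamiltonian_exponent n \<beta> lam h J' (\<lambda>i. z (m + i)))
      = f m J (\<lambda>i\<in>{..<m}. z i) * f n J' (\<lambda>i\<in>{..<n}. z (m + i))" for z
  proof -
    have "hamiltonian_exponent m \<beta> lam h J z = hamiltonian_exponent m \<beta> lam h J (\<lambda>i\<in>{..<m}. z i)"
      "hamiltonian_exponent n \<beta> lam h J' (\<lambda>i. z (m + i)) = hamiltonian_exponent n \<beta> lam h J' (\<lambda>i\<in>{..<n}. z (m + i))"
      by (rule hamiltonian_exponent_cong; simp)+
    moreover have "z \<in> cube (m + n) R \<longleftrightarrow> (\<lambda>i\<in>{..<m}. z i) \<in> cube m R \<and> (\<lambda>i\<in>{..<n}. z (m + i)) \<in> cube n R"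
    proof -
      have "(\<forall>i<m + n. \<bar>z i\<bar> \<le> R) \<longleftrightarrow> (\<forall>i<m. \<bar>z i\<bar> \<le> R) \<and> (\<forall>i<n. \<bar>z (m + i)\<bar> \<le> R)"
        by (auto simp: all_less_add)
      then show ?thesis by (auto simp: cube_def)
    qed
    ultimately show ?thesis by (auto simp: f_def exp_add indicator_def)
  qed
  then show ?thesis
    using integral_std_gauss_split[OF meas meas a b]
    unfolding weighted_partition_def gauss_vec_eq f_def by simp
qed

text \<open>Both systems are the same Gaussian field under two profiles. Decoupling is not a change
  of the field but variance zero on the mixed pairs and a larger variance, \<open>1 / m\<close> or
  \<open>1 / n\<close>, on the diagonal blocks.\<close>

lemma cut_superadditive:
  assumes \<beta>: "\<beta> > 0" and m: "m \<ge> 1" and n: "n \<ge> 1" and R: "R > 0" and d: "d > 0"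
  shows "(\<integral>J. ln (d + cut_partition m \<beta> lam h R J * cut_partition n \<beta> lam h R (shift_disorder m J)) \<partial>disorder (m + n))
       \<le> (\<integral>J. ln (d + cut_partition (m + n) \<beta> lam h R J) \<partial>disorder (m + n))"
proof -
  let ?N = "m + n"
  let ?I = "{..<?N} \<times> {..<?N}"
  \<comment> \<open>The cube indicator makes \<open>F\<close> bounded as the locale demands. It does
    not change the integrals: \<open>X\<close> carries the same indicator and vanishes outside the
    cube.\<close>
  define F where "F p z = (\<beta> / sqrt 2 * z (fst p) * z (snd p)) * indicator (cube ?N R) z"
    for p :: "nat \<times> nat" and z
  define X where "X z = indicator (cube ?N R) z * exp (\<beta> * h * (\<Sum>i<?N. z i) + lam / 2 * (\<Sum>i<?N. (z i)\<^sup>2))"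
    for z
  define u :: "nat \<times> nat \<Rightarrow> real" where "u p = 1 / real ?N" for p
  define v :: "nat \<times> nat \<Rightarrow> real" where
    "v p = (if fst p < m \<and> snd p < m then 1 / real m
            else if m \<le> fst p \<and> m \<le> snd p then 1 / real n else 0)" for p
  interpret gauss_field "gauss_vec ?N" ?I F "\<beta> / sqrt 2 * (R * R)"
  proof (unfold gauss_vec_eq, intro gauss_field.intro gauss_field_axioms.intro prob_space_std_gauss)
    fix p assume p: "p \<in> ?I"
    then have [measurable]: "(\<lambda>z. z (fst p)) \<in> borel_measurable (std_gauss {..<?N})"
      "(\<lambda>z. z (snd p)) \<in> borel_measurable (std_gauss {..<?N})"
      by (auto intro!: measurable_std_gauss_component)
    show "F p \<in> borel_measurable (std_gauss {..<?N})" unfolding F_def[abs_def] by measurable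
    show "\<bar>F p z\<bar> \<le> \<beta> / sqrt 2 * (R * R)" for z
    proof (cases "z \<in> cube ?N R")
      case True
      then have "\<bar>z (fst p)\<bar> * \<bar>z (snd p)\<bar> \<le> R * R"
        using p R by (intro mult_mono) (auto simp: cube_def)
      then have "\<beta> / sqrt 2 * (\<bar>z (fst p)\<bar> * \<bar>z (snd p)\<bar>) \<le> \<beta> / sqrt 2 * (R * R)"
        using \<beta> by (intro mult_left_mono) auto
      then show ?thesis using True \<beta> by (simp add: F_def abs_mult mult.assoc)
    next
      case False
      then show ?thesis using \<beta> R by (simp add: F_def)
    qed
  qed (use \<beta> R in auto)
  have X: "X \<in> borel_measurable (gauss_vec ?N)"
    unfolding X_def[abs_def] gauss_vec_eq by measurable
  have X0: "0 \<le> X z" for z by (simp add: X_def)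
  define W where "W = exp (\<bar>\<beta> * h\<bar> * (real ?N * R) + \<bar>lam\<bar> / 2 * (real ?N * R\<^sup>2))"
  have XW: "X z \<le> W" for z
  proof (cases "z \<in> cube ?N R")
    case True
    then have z: "\<bar>z i\<bar> \<le> R" if "i < ?N" for i using that by (simp add: cube_def)
    have "\<bar>\<Sum>i<?N. z i\<bar> \<le> (\<Sum>i<?N. R)"
      using z by (intro order_trans[OF sum_abs sum_mono]) auto
    then have 1: "\<bar>\<beta> * h * (\<Sum>i<?N. z i)\<bar> \<le> \<bar>\<beta> * h\<bar> * (real ?N * R)"
      unfolding abs_mult[of "\<beta> * h"] by (intro mult_left_mono) auto
    have "(z i)\<^sup>2 \<le> R\<^sup>2" if "i < ?N" for i
      using z[OF that] R by (simp add: abs_le_square_iff[symmetric])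
    then have "(\<Sum>i<?N. (z i)\<^sup>2) \<le> (\<Sum>i<?N. R\<^sup>2)" by (intro sum_mono) auto
    moreover have "0 \<le> (\<Sum>i<?N. (z i)\<^sup>2)" by (intro sum_nonneg) auto
    ultimately have 2: "\<bar>lam / 2 * (\<Sum>i<?N. (z i)\<^sup>2)\<bar> \<le> \<bar>lam\<bar> / 2 * (real ?N * R\<^sup>2)"
      unfolding abs_mult by (intro mult_mono) auto
    show ?thesis using True 1 2 unfolding X_def W_def by simp
  next
    case False
    then show ?thesis by (simp add: X_def W_def)
  qed
  have u01: "0 \<le> u p \<and> u p \<le> 1" and v01: "0 \<le> v p \<and> v p \<le> 1" for p
    using m n by (auto simp: u_def v_def)
  have cov_le: "cov u z z' \<le> cov v z z'" for z z'
  proof -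
    \<comment> \<open>Both covariances are the nonnegative factor \<open>c\<close> times a quadratic
      form in the overlap terms \<open>y i = z i * z' i\<close>. For \<open>u\<close> it is the
      square of the total overlap over \<open>m + n\<close>, for \<open>v\<close> the sum of the
      block squares over \<open>m\<close> and \<open>n\<close>, and convexity compares the
      two.\<close>
    define c where "c = \<beta>\<^sup>2 / 2 * (indicator (cube ?N R) z * indicator (cube ?N R) z')"
    define y where "y i = z i * z' i" for i
    have c: "0 \<le> c" by (simp add: c_def)
    have FF: "F p z * F p z' = c * (y (fst p) * y (snd p))" for p
      by (simp add: F_def c_def y_def power2_eq_square)
    have cov_eq: "cov s z z' = c * (\<Sum>p\<in>?I. s p * (y (fst p) * y (snd p)))" for s
      unfolding cov_def FF sum_distrib_left by (intro sum.cong refl) simp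
    have "(\<Sum>p\<in>?I. u p * (y (fst p) * y (snd p))) = 1 / real ?N * ((\<Sum>i<m. y i) + (\<Sum>i<n. y (m + i)))\<^sup>2"
      unfolding sum_lessThan_add[symmetric] sum_square_eq_double_sum[symmetric]
      by (simp add: u_def sum.cartesian_product split_beta' sum_distrib_left sum_divide_distrib)
    also have "\<dots> \<le> 1 / real m * (\<Sum>i<m. y i)\<^sup>2 + 1 / real n * (\<Sum>i<n. y (m + i))\<^sup>2"
      by (rule square_sum_le[OF m n])
    also have "\<dots> = (\<Sum>p\<in>?I. if fst p < m \<and> snd p < m then 1 / real m * (y (fst p) * y (snd p))
        else if m \<le> fst p \<and> m \<le> snd p then 1 / real n * (y (fst p) * y (snd p)) else 0)"
      unfolding sum_diagonal_blocks
      by (simp add: sum_square_eq_double_sum[symmetric] sum_distrib_left sum_divide_distrib)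
    also have "\<dots> = (\<Sum>p\<in>?I. v p * (y (fst p) * y (snd p)))"
      by (intro sum.cong refl) (simp add: v_def)
    finally show ?thesis unfolding cov_eq using c by (rule mult_left_mono)
  qed
  have wu: "wick_int X u (scaled u J) = cut_partition ?N \<beta> lam h R J" for J
    unfolding wick_int_def weighted_partition_def
  proof (intro Bochner_Integration.integral_cong refl)
    fix z
    show "X z * wick_exp u (scaled u J) z = indicator (cube ?N R) z * exp (hamiltonian_exponent ?N \<beta> lam h J z)"
    proof (cases "z \<in> cube ?N R")
      case True
      then have "(\<Sum>p\<in>?I. scaled u J p * F p z) - (\<Sum>p\<in>?I. u p * (F p z)\<^sup>2) / 2
        = (\<Sum>i<?N. \<Sum>j<?N. sqrt (1 / real ?N) * J (i, j) * (\<beta> / sqrt 2 * z i * z j))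
          - (\<Sum>i<?N. \<Sum>j<?N. 1 / real ?N * (\<beta> / sqrt 2 * z i * z j)\<^sup>2) / 2"
        unfolding sum.cartesian_product split_beta'
        by (intro arg_cong2[where f="(-)"] arg_cong2[where f="(/)"] refl sum.cong)
           (simp_all add: scaled_def u_def F_def)
      then show ?thesis
        using wick_exponent_eq_hamiltonian[of ?N \<beta> h z lam J] m True
        by (simp add: X_def wick_exp_def exp_add[symmetric])
    qed (simp add: X_def)
  qed
  have wv: "wick_int X v (scaled v J) = cut_partition m \<beta> lam h R J * cut_partition n \<beta> lam h R (shift_disorder m J)" for J
    unfolding cut_partition_split[OF \<beta> m n, symmetric] wick_int_def
  proof (intro Bochner_Integration.integral_cong refl)
    fix z
    let ?E = "hamiltonian_exponent m \<beta> lam h J z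
        + hamiltonian_exponent n \<beta> lam h (shift_disorder m J) (\<lambda>i. z (m + i))"
    show "X z * wick_exp v (scaled v J) z = indicator (cube ?N R) z * exp ?E"
    proof (cases "z \<in> cube ?N R")
      case True
      define g where "g p = \<beta> / sqrt 2 * z (fst p) * z (snd p)" for p
      have "(\<Sum>p\<in>?I. scaled v J p * F p z)
        = (\<Sum>p\<in>?I. if fst p < m \<and> snd p < m then sqrt (1 / real m) * J p * g p
            else if m \<le> fst p \<and> m \<le> snd p then sqrt (1 / real n) * J p * g p else 0)"
        using True by (intro sum.cong refl) (simp add: scaled_def v_def F_def g_def)
      moreover have "(\<Sum>p\<in>?I. v p * (F p z)\<^sup>2)
        = (\<Sum>p\<in>?I. if fst p < m \<and> snd p < m then 1 / real m * (g p)\<^sup>2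
            else if m \<le> fst p \<and> m \<le> snd p then 1 / real n * (g p)\<^sup>2 else 0)"
        using True by (intro sum.cong refl) (simp add: v_def F_def g_def)
      \<comment> \<open>The mixed pairs contribute to neither sum, and the remaining diagonal blocks
        are two instances of the Wick form of the Hamiltonian, the second with site indices and
        disorder shifted by \<open>m\<close>.\<close>
      ultimately have "\<beta> * h * (\<Sum>i<?N. z i) + lam / 2 * (\<Sum>i<?N. (z i)\<^sup>2)
          + ((\<Sum>p\<in>?I. scaled v J p * F p z) - (\<Sum>p\<in>?I. v p * (F p z)\<^sup>2) / 2) = ?E"
        using wick_exponent_eq_hamiltonian[of m \<beta> h z lam J, OF m]
          wick_exponent_eq_hamiltonian[of n \<beta> h "\<lambda>i. z (m + i)" lam "shift_disorder m J", OF n]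
        unfolding sum_diagonal_blocks sum_lessThan_add g_def shift_disorder_def fst_conv snd_conv
          distrib_left add_divide_distrib
        by linarith
      then show ?thesis using True by (simp add: X_def wick_exp_def exp_add[symmetric])
    qed (simp add: X_def)
  qed
  have "free_energy d X v \<le> free_energy d X u"
    by (rule free_energy_antimono[OF X X0 XW d u01 v01 cov_le])
  then show ?thesis unfolding free_energy_def wu wv disorder_eq .
qed

section \<open>Restriction of the disorder to blocks and removal of the cutoffs\<close>

lemma weighted_partition_reindex_measurable:
  assumes "t \<in> {..<m} \<times> {..<m} \<rightarrow> {..<N} \<times> {..<N}" and w: "w \<in> borel_measurable (gauss_vec m)"
  shows "(\<lambda>J. weighted_partition m \<beta> lam h w (\<lambda>p. J (t p))) \<in> borel_measurable (disorder N)"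
proof -
  have "(\<lambda>J. weighted_partition m \<beta> lam h w (\<lambda>p\<in>{..<m} \<times> {..<m}. J (t p))) \<in> borel_measurable (disorder N)"
    unfolding disorder_eq
    by (rule measurable_compose[OF measurable_std_gauss_reindex[OF assms(1)]
          weighted_partition_measurable[OF w, unfolded disorder_eq]])
  moreover have "weighted_partition m \<beta> lam h w (\<lambda>p\<in>{..<m} \<times> {..<m}. J (t p))
      = weighted_partition m \<beta> lam h w (\<lambda>p. J (t p))" for J
    by (rule weighted_partition_cong) simp
  ultimately show ?thesis by simp
qed

text \<open>Entries picked by an injective index map are again independent standard Gaussians, so
  each block may be averaged over the disorder of the whole system. The restricted function enters
  because product measures live on extensional functions.\<close>

lemma integral_ln_partition_reindex:
  assumes t: "inj_on t ({..<m} \<times> {..<m})" "t \<in> {..<m} \<times> {..<m} \<rightarrow> {..<N} \<times> {..<N}"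
  shows "(\<integral>J. ln (partition_fn m \<beta> lam h (\<lambda>p. J (t p))) \<partial>disorder N)
       = (\<integral>J. ln (partition_fn m \<beta> lam h J) \<partial>disorder m)"
proof -
  have "partition_fn m \<beta> lam h (\<lambda>p\<in>{..<m} \<times> {..<m}. J (t p)) = partition_fn m \<beta> lam h (\<lambda>p. J (t p))" for J
    unfolding partition_fn_eq_weighted by (rule weighted_partition_cong) simp
  moreover have "(\<lambda>J. ln (partition_fn m \<beta> lam h J)) \<in> borel_measurable (std_gauss ({..<m} \<times> {..<m}))"
    using weighted_partition_measurable[of "\<lambda>_. 1" m \<beta> lam h]
    unfolding partition_fn_eq_weighted disorder_eq by measurable
  ultimately show ?thesis
    using integral_std_gauss_reindex[OF t, of "\<lambda>J. ln (partition_fn m \<beta> lam h J)"]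
    unfolding disorder_eq by simp
qed

lemma indicator_cube_mono: "R \<le> R' \<Longrightarrow> indicator (cube N R) z \<le> (indicator (cube N R') z :: real)"
  by (auto simp: indicator_def cube_def intro: order_trans)

lemma disorder_sq_reindex_le:
  assumes "m + k \<le> N"
  shows "disorder_sq m (\<lambda>p. J (k + fst p, k + snd p)) \<le> disorder_sq N J"
proof -
  have inj: "inj_on (\<lambda>p. (k + fst p, k + snd p)) ({..<m} \<times> {..<m})"
    by (auto simp: inj_on_def)
  have "disorder_sq m (\<lambda>p. J (k + fst p, k + snd p))
      = (\<Sum>p\<in>{..<m} \<times> {..<m}. (J (k + fst p, k + snd p))\<^sup>2)"
    unfolding disorder_sq_def sum.cartesian_product by (intro sum.cong refl) auto
  also have "\<dots> = (\<Sum>p\<in>(\<lambda>p. (k + fst p, k + snd p)) ` ({..<m} \<times> {..<m}). (J p)\<^sup>2)"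
    by (simp add: sum.reindex[OF inj])
  also have "\<dots> \<le> (\<Sum>p\<in>{..<N} \<times> {..<N}. (J p)\<^sup>2)"
    using assms by (intro sum_mono2) auto
  also have "\<dots> = disorder_sq N J"
    unfolding disorder_sq_def sum.cartesian_product by (intro sum.cong refl) auto
  finally show ?thesis .
qed

lemma pressure_eq: "N \<ge> 1 \<Longrightarrow> real N * pressure N \<beta> lam h = (\<integral>J. ln (partition_fn N \<beta> lam h J) \<partial>disorder N)"
  by (simp add: pressure_def)

theorem mainTheorem2:
  fixes \<beta> lam h :: real and N1 N2 :: nat
  assumes "\<beta> > 0" and "N1 \<ge> 1" and "N2 \<ge> 1"
  shows "real (N1 + N2) * pressure (N1 + N2) \<beta> lam h
           \<ge> real N1 * pressure N1 \<beta> lam h + real N2 * pressure N2 \<beta> lam h"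
proof -
  note \<beta> = assms(1) and N1 = assms(2) and N2 = assms(3)
  let ?N = "N1 + N2"
  have N: "?N \<ge> 1" using N1 by simp
  \<comment> \<open>\<open>t k\<close> shifts both indices of a pair by \<open>k\<close>. Since
    \<open>t 0\<close> is the identity, the same reindexing lemmas handle the two blocks.\<close>
  define t where "t k p = (k + fst p, k + snd p)" for k :: nat and p :: "nat \<times> nat"
  have t1: "t 0 \<in> {..<N1} \<times> {..<N1} \<rightarrow> {..<?N} \<times> {..<?N}"
    and t2: "t N1 \<in> {..<N2} \<times> {..<N2} \<rightarrow> {..<?N} \<times> {..<?N}" by (auto simp: t_def)
  have inj: "inj_on (t k) A" for k A by (auto simp: t_def inj_on_def prod_eq_iff)
  have t0: "(\<lambda>p. J (t 0 p)) = J" for J :: "nat \<times> nat \<Rightarrow> real" by (simp add: t_def)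
  have shift: "shift_disorder N1 J = (\<lambda>p. J (t N1 p))" for J by (simp add: shift_disorder_def t_def)
  have S1: "disorder_sq N1 J \<le> disorder_sq ?N J" for J
    using disorder_sq_reindex_le[of N1 0 ?N J] by simp
  have S2: "disorder_sq N2 (shift_disorder N1 J) \<le> disorder_sq ?N J" for J
    using disorder_sq_reindex_le[of N2 N1 ?N J] by (simp add: shift_disorder_def)

  have one: "(\<lambda>_. 1 :: real) \<in> borel_measurable (gauss_vec k)" for k by simp
  have one_le: "indicator (cube k 1) z \<le> (1 :: real)" for k z by (simp add: indicator_def)
  \<comment> \<open>The radii are \<open>Suc n\<close> rather than \<open>n\<close>, so every cube
    contains the unit cube and the uniform logarithmic bound applies from the first index
    on.\<close>
  have cut_ge: "indicator (cube k 1) z \<le> (indicator (cube k (real (Suc n))) z :: real)" for k z n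
    by (rule indicator_cube_mono) simp
  have cut_le: "indicator (cube k R) z \<le> (1 :: real)" for k R z by (simp add: indicator_def)

  obtain C where C: "0 \<le> C" "\<And>w d J. w \<in> borel_measurable (gauss_vec ?N) \<Longrightarrow> (\<And>z. indicator (cube ?N 1) z \<le> w z) \<Longrightarrow>
       (\<And>z. w z \<le> 1) \<Longrightarrow> 0 \<le> d \<Longrightarrow> d \<le> 1 \<Longrightarrow> 0 < weighted_partition ?N \<beta> lam h w J \<and>
       \<bar>ln (d + weighted_partition ?N \<beta> lam h w J)\<bar> \<le> C * (1 + disorder_sq ?N J)"
    using ln_weighted_partition_bound[OF \<beta> N, of lam h] by metis
  obtain C1 where C1: "0 \<le> C1" "\<And>w d J. w \<in> borel_measurable (gauss_vec N1) \<Longrightarrow> (\<And>z. indicator (cube N1 1) z \<le> w z) \<Longrightarrow>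
       (\<And>z. w z \<le> 1) \<Longrightarrow> 0 \<le> d \<Longrightarrow> d \<le> 1 \<Longrightarrow> 0 < weighted_partition N1 \<beta> lam h w J \<and>
       \<bar>ln (d + weighted_partition N1 \<beta> lam h w J)\<bar> \<le> C1 * (1 + disorder_sq N1 J)"
    using ln_weighted_partition_bound[OF \<beta> N1, of lam h] by metis
  obtain C2 where C2: "0 \<le> C2" "\<And>w d J. w \<in> borel_measurable (gauss_vec N2) \<Longrightarrow> (\<And>z. indicator (cube N2 1) z \<le> w z) \<Longrightarrow>
       (\<And>z. w z \<le> 1) \<Longrightarrow> 0 \<le> d \<Longrightarrow> d \<le> 1 \<Longrightarrow> 0 < weighted_partition N2 \<beta> lam h w J \<and>
       \<bar>ln (d + weighted_partition N2 \<beta> lam h w J)\<bar> \<le> C2 * (1 + disorder_sq N2 J)"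
    using ln_weighted_partition_bound[OF \<beta> N2, of lam h] by metis
  define K where "K = 2 * (C1 + C2)"

  interpret D: prob_space "disorder ?N" unfolding disorder_eq by (rule prob_space_std_gauss)
  have int_bound: "integrable (disorder ?N) (\<lambda>J. c * (1 + disorder_sq ?N J))" for c
    using integrable_disorder_sq[of ?N] by auto

  let ?Z = "partition_fn ?N \<beta> lam h"
  let ?Z1 = "partition_fn N1 \<beta> lam h"
  let ?Z2 = "\<lambda>J. partition_fn N2 \<beta> lam h (shift_disorder N1 J)"
  let ?c = "\<lambda>n. cut_partition ?N \<beta> lam h (real (Suc n))"
  let ?c1 = "\<lambda>n. cut_partition N1 \<beta> lam h (real (Suc n))"
  let ?c2 = "\<lambda>n J. cut_partition N2 \<beta> lam h (real (Suc n)) (shift_disorder N1 J)"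
  \<comment> \<open>The shift tends to zero along the same index as the radius tends to infinity, so
    one limit removes both regularisations. All values are at most one, as the uniform bound
    requires.\<close>
  let ?d = "\<lambda>n. 1 / real (Suc n)"

  have [measurable]: "?c n \<in> borel_measurable (disorder ?N)" "?Z \<in> borel_measurable (disorder ?N)" for n
    unfolding partition_fn_eq_weighted
    by (intro weighted_partition_measurable indicator_cube_gauss_vec one)+
  have [measurable]: "?c1 n \<in> borel_measurable (disorder ?N)" "?Z1 \<in> borel_measurable (disorder ?N)" for n
    using weighted_partition_reindex_measurable[OF t1 indicator_cube_gauss_vec, of \<beta> lam h]
      weighted_partition_reindex_measurable[OF t1 one, of \<beta> lam h]
    unfolding partition_fn_eq_weighted t0 by auto
  have [measurable]: "?c2 n \<in> borel_measurable (disorder ?N)" "?Z2 \<in> borel_measurable (disorder ?N)" for n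
    unfolding shift partition_fn_eq_weighted
    by (intro weighted_partition_reindex_measurable t2 indicator_cube_gauss_vec one)+

  have Zpos: "0 < ?Z J" "0 < ?Z1 J" "0 < ?Z2 J" for J
    unfolding partition_fn_eq_weighted
    using C(2)[OF one one_le, of 0 J] C1(2)[OF one one_le, of 0 J] C2(2)[OF one one_le, of 0 "shift_disorder N1 J"]
    by auto
  have d_lim: "?d \<longlonglongrightarrow> 0" by (rule lim_1_over_n[THEN LIMSEQ_Suc])

  have lim_joint: "(\<lambda>n. \<integral>J. ln (?d n + ?c n J) \<partial>disorder ?N) \<longlonglongrightarrow> (\<integral>J. ln (?Z J) \<partial>disorder ?N)"
  proof (rule integral_dominated_convergence[OF _ _ int_bound[of C]])
    show "AE J in disorder ?N. (\<lambda>n. ln (?d n + ?c n J)) \<longlonglongrightarrow> ln (?Z J)"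
    proof (intro AE_I2)
      fix J
      have "(\<lambda>n. ?d n + ?c n J) \<longlonglongrightarrow> 0 + ?Z J"
        by (intro tendsto_add d_lim cut_partition_tendsto \<beta> N)
      then show "(\<lambda>n. ln (?d n + ?c n J)) \<longlonglongrightarrow> ln (?Z J)"
        using Zpos(1)[of J] by (intro tendsto_ln) auto
    qed
    show "AE J in disorder ?N. norm (ln (?d n + ?c n J)) \<le> C * (1 + disorder_sq ?N J)" for n
      using C(2)[OF indicator_cube_gauss_vec cut_ge cut_le, of "?d n"] by (intro AE_I2) simp
  qed measurable

  \<comment> \<open>With the shift present the logarithm of the product does not split. As
    \<open>?d n \<le> 1\<close>, the argument lies between \<open>?a * ?b\<close> and
    \<open>(1 + ?a) * (1 + ?b)\<close>, and the logarithms of both ends do split into terms covered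
    by the uniform bounds with \<open>d = 0\<close> and \<open>d = 1\<close>.\<close>
  have prod_bound: "\<bar>ln (?d n + ?c1 n J * ?c2 n J)\<bar> \<le> K * (1 + disorder_sq ?N J)" for n J
  proof -
    let ?a = "?c1 n J" and ?b = "?c2 n J"
    have a: "0 < ?a" "\<bar>ln ?a\<bar> \<le> C1 * (1 + disorder_sq N1 J)" "\<bar>ln (1 + ?a)\<bar> \<le> C1 * (1 + disorder_sq N1 J)"
      using C1(2)[OF indicator_cube_gauss_vec cut_ge cut_le, of 0 n J]
        C1(2)[OF indicator_cube_gauss_vec cut_ge cut_le, of 1 n J] by auto
    have b: "0 < ?b" "\<bar>ln ?b\<bar> \<le> C2 * (1 + disorder_sq N2 (shift_disorder N1 J))"
      "\<bar>ln (1 + ?b)\<bar> \<le> C2 * (1 + disorder_sq N2 (shift_disorder N1 J))"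
      using C2(2)[OF indicator_cube_gauss_vec cut_ge cut_le, of 0 n "shift_disorder N1 J"]
        C2(2)[OF indicator_cube_gauss_vec cut_ge cut_le, of 1 n "shift_disorder N1 J"] by auto
    have ab: "0 < ?a * ?b" using a b by simp
    have "ln ?a + ln ?b = ln (?a * ?b)" using a b by (simp add: ln_mult_pos)
    also have "\<dots> \<le> ln (?d n + ?a * ?b)"
      using ab by (subst ln_le_cancel_iff) (auto intro: add_nonneg_pos)
    finally have lo: "ln ?a + ln ?b \<le> ln (?d n + ?a * ?b)" .
    have "?d n \<le> 1" by simp
    then have "?d n + ?a * ?b \<le> (1 + ?a) * (1 + ?b)"
      using a b unfolding distrib_left distrib_right by linarith
    then have "ln (?d n + ?a * ?b) \<le> ln ((1 + ?a) * (1 + ?b))"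
      using a b ab by (subst ln_le_cancel_iff) (auto intro: add_nonneg_pos mult_pos_pos add_pos_pos)
    also have "\<dots> = ln (1 + ?a) + ln (1 + ?b)" using a b by (simp add: ln_mult_pos add_pos_pos)
    finally have up: "ln (?d n + ?a * ?b) \<le> ln (1 + ?a) + ln (1 + ?b)" .
    have "C1 * (1 + disorder_sq N1 J) \<le> C1 * (1 + disorder_sq ?N J)"
      "C2 * (1 + disorder_sq N2 (shift_disorder N1 J)) \<le> C2 * (1 + disorder_sq ?N J)"
      using S1 S2 C1(1) C2(1) by (auto intro!: mult_left_mono)
    moreover have "0 \<le> C1 * (1 + disorder_sq ?N J)" "0 \<le> C2 * (1 + disorder_sq ?N J)"
      using C1(1) C2(1) disorder_sq_nonneg[of ?N J] by auto
    moreover have "K * (1 + disorder_sq ?N J) = 2 * (C1 * (1 + disorder_sq ?N J)) + 2 * (C2 * (1 + disorder_sq ?N J))"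
      unfolding K_def by (simp add: algebra_simps)
    ultimately show ?thesis using lo up a(2,3) b(2,3) by linarith
  qed

  have lim_split: "(\<lambda>n. \<integral>J. ln (?d n + ?c1 n J * ?c2 n J) \<partial>disorder ?N)
      \<longlonglongrightarrow> (\<integral>J. ln (?Z1 J) + ln (?Z2 J) \<partial>disorder ?N)"
  proof (rule integral_dominated_convergence[OF _ _ int_bound[of K]])
    show "AE J in disorder ?N. (\<lambda>n. ln (?d n + ?c1 n J * ?c2 n J)) \<longlonglongrightarrow> ln (?Z1 J) + ln (?Z2 J)"
    proof (intro AE_I2)
      fix J
      have "(\<lambda>n. ?d n + ?c1 n J * ?c2 n J) \<longlonglongrightarrow> 0 + ?Z1 J * ?Z2 J"
        by (intro tendsto_add tendsto_mult d_lim cut_partition_tendsto \<beta> N1 N2)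
      then have "(\<lambda>n. ln (?d n + ?c1 n J * ?c2 n J)) \<longlonglongrightarrow> ln (?Z1 J * ?Z2 J)"
        using Zpos(2,3)[of J] by (intro tendsto_ln) auto
      then show "(\<lambda>n. ln (?d n + ?c1 n J * ?c2 n J)) \<longlonglongrightarrow> ln (?Z1 J) + ln (?Z2 J)"
        using Zpos(2,3)[of J] by (simp add: ln_mult_pos)
    qed
    show "AE J in disorder ?N. norm (ln (?d n + ?c1 n J * ?c2 n J)) \<le> K * (1 + disorder_sq ?N J)" for n
      using prod_bound by (intro AE_I2) simp
  qed measurable

  have int1: "integrable (disorder ?N) (\<lambda>J. ln (?Z1 J))"
  proof (rule Bochner_Integration.integrable_bound[OF int_bound[of C1]])
    show "AE J in disorder ?N. norm (ln (?Z1 J)) \<le> norm (C1 * (1 + disorder_sq ?N J))"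
    proof (intro AE_I2)
      fix J
      have "\<bar>ln (?Z1 J)\<bar> \<le> C1 * (1 + disorder_sq N1 J)"
        using C1(2)[OF one one_le, of 0 J] by (simp add: partition_fn_eq_weighted)
      also have "\<dots> \<le> C1 * (1 + disorder_sq ?N J)" using S1 C1(1) by (auto intro!: mult_left_mono)
      finally show "norm (ln (?Z1 J)) \<le> norm (C1 * (1 + disorder_sq ?N J))" by simp
    qed
  qed measurable
  have int2: "integrable (disorder ?N) (\<lambda>J. ln (?Z2 J))"
  proof (rule Bochner_Integration.integrable_bound[OF int_bound[of C2]])
    show "AE J in disorder ?N. norm (ln (?Z2 J)) \<le> norm (C2 * (1 + disorder_sq ?N J))"
    proof (intro AE_I2)
      fix J
      have "\<bar>ln (?Z2 J)\<bar> \<le> C2 * (1 + disorder_sq N2 (shift_disorder N1 J))"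
        using C2(2)[OF one one_le, of 0 "shift_disorder N1 J"] by (simp add: partition_fn_eq_weighted)
      also have "\<dots> \<le> C2 * (1 + disorder_sq ?N J)" using S2 C2(1) by (auto intro!: mult_left_mono)
      finally show "norm (ln (?Z2 J)) \<le> norm (C2 * (1 + disorder_sq ?N J))" by simp
    qed
  qed measurable

  have "real N1 * pressure N1 \<beta> lam h + real N2 * pressure N2 \<beta> lam h
      = (\<integral>J. ln (?Z1 J) \<partial>disorder ?N) + (\<integral>J. ln (?Z2 J) \<partial>disorder ?N)"
    using integral_ln_partition_reindex[OF inj t1, of \<beta> lam h] integral_ln_partition_reindex[OF inj t2, of \<beta> lam h]
    unfolding t0 by (simp only: pressure_eq[OF N1] pressure_eq[OF N2] shift)
  also have "\<dots> = (\<integral>J. ln (?Z1 J) + ln (?Z2 J) \<partial>disorder ?N)"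
    using int1 int2 by simp
  also have "\<dots> \<le> (\<integral>J. ln (?Z J) \<partial>disorder ?N)"
    \<comment> \<open>The regularised inequality holds for every \<open>n\<close>, with positive
      radius and shift, and passes to the limit.\<close>
    by (rule LIMSEQ_le[OF lim_split lim_joint]) (intro exI allI impI cut_superadditive \<beta> N1 N2; simp)
  also have "\<dots> = real ?N * pressure ?N \<beta> lam h"
    by (simp only: pressure_eq[OF N])
  finally show ?thesis .
qed

end
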